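(* Let $\mathcal{C}$ be a closed symmetric monoidal category which has equalizers, and let $\mathcal{T}$ be a one-object category enriched over $\mathcal{C}$, with hom-object $T$, composition $\mu:T\otimes T\to T$ and unit $\iota:1_{\mathcal{C}}\to T$. Let $\Phi:T\otimes\Omega\to\Omega$ be a left action of $T$ on an object $\Omega$ of $\mathcal{C}$. Then: (i) There is an equalizer $q:E_\Phi\to[T;\Omega]$ of the two morphisms $\mathrm{shift}_\Omega^\flat,\ \mathrm{Tr}_\Phi^\flat:[T;\Omega]\to[T;[T;\Omega]]$. (ii) $E_\Phi$ is a subobject of $[T;\Omega]$ (via $q$). (iii) There exists a unique morphism $\mathrm{shift}_\Phi:T\otimes E_\Phi\to E_\Phi$ such that $$q\circ\mathrm{shift}_\Phi=\mathrm{shift}_\Omega\circ(T\otimes q)\quad\text{and}\quad q\circ\mathrm{shift}_\Phi=\mathrm{Tr}_\Phi\circ(T\otimes q).$$ (iv) The morphism $\mathrm{shift}_\Phi$ is a left action of $T$ on $E_\Phi$. (v) Let $\Psi:T\otimes\Omega'\to\Omega'$ be a left action of $T$ and let $f:\Phi\to\Psi$ be a morphism of left actions, given by $f:\Omega\to\Omega'$. Let $q':E_\Psi\to[T;\Omega']$ be the corresponding equalizer for $\Psi$. Then there is a unique morphism $E(f):E_\Phi\to E_\Psi$ such that $$q'\circ E(f)=[T;f]\circ q\quad\text{and}\quad E(f)\circ\mathrm{shift}_\Phi=\mathrm{shift}_\Psi\circ(T\otimes E(f)).$$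
   Context: Time: the time semigroup $\mathcal{T}$ (with identity) is viewed as a one-object category enriched over $\mathcal{C}$; $(T,\mu,\iota)$ is then a monoid object in $\mathcal{C}$. Associators are suppressed. Internal homs: $[y;z]$ is the internal hom, with $\mathrm{Hom}(y\otimes x;z)\cong\mathrm{Hom}(x;[y;z])$ and evaluation $\mathrm{eval}:y\otimes[y;z]\to z$. For a morphism $F:T\otimes X\to X$, $F^\flat:X\to[T;X]$ is its adjoint under this bijection. Left action: $\Psi:T\otimes X\to X$ is a left action of $T$ if $\Psi\circ(\iota\otimes X)$ is the canonical isomorphism $1_{\mathcal{C}}\otimes X\cong X$ and $\Psi\circ(T\otimes\Psi)=\Psi\circ(\mu\otimes X)$. A morphism of left actions $(X,\Psi)\to(X',\Psi')$ is a morphism $h:X\to X'$ with $h\circ\Psi=\Psi'\circ(T\otimes h)$. Shift: $\mathrm{shift}_\Omega:T\otimes[T;\Omega]\to[T;\Omega]$ is the adjoint, with respect to the first (leftmost) factor $T$, of $T\otimes T\otimes[T;\Omega]\xrightarrow{\mu\otimes[T;\Omega]}T\otimes[T;\Omega]\xrightarrow{\mathrm{eval}}\Omega$. Transfer operator: $\mathrm{Tr}_\Phi:T\otimes[T;\Omega]\to[T;\Omega]$ is the adjoint, with respect to the first (leftmost) factor $T$, of $T\otimes T\otimes[T;\Omega]\xrightarrow{\mathrm{swap}_{T,T}\otimes[T;\Omega]}T\otimes T\otimes[T;\Omega]\xrightarrow{T\otimes\mathrm{eval}}T\otimes\Omega\xrightarrow{\Phi}\Omega$, where $\mathrm{swap}$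 is the symmetry of $\mathcal{C}$. *)

theory Defs
  imports Main
begin

section \<open>Categories\<close>

text \<open>Objects and arrows are the elements of two carrier sets; \<open>dom\<close>, \<open>cod\<close>, \<open>ide\<close> and
  composition are unconstrained outside these carriers. Composition is written in
  applicative order: \<open>g \<cdot> f\<close> is \<open>g\<close> after \<open>f\<close>.\<close>

record ('o, 'm) category =
  Ob :: "'o set"
  Arr :: "'m set"
  Dom :: "'m \<Rightarrow> 'o"
  Cod :: "'m \<Rightarrow> 'o"
  ide :: "'o \<Rightarrow> 'm"  (\<open>\<one>\<index> _\<close> [1000] 1000)
  comp :: "'m \<Rightarrow> 'm \<Rightarrow> 'm"  (infixr \<open>\<cdot>\<index>\<close> 65)

definition hom :: "('o, 'm, 'x) category_scheme \<Rightarrow> 'o \<Rightarrow> 'o \<Rightarrow> 'm set" where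
  "hom C a b = {f \<in> Arr C. Dom C f = a \<and> Cod C f = b}"

locale category =
  fixes C :: "('o, 'm, 'x) category_scheme" (structure)
  assumes dom_closed: "f \<in> Arr C \<Longrightarrow> Dom C f \<in> Ob C"
    and cod_closed: "f \<in> Arr C \<Longrightarrow> Cod C f \<in> Ob C"
    and ide_closed: "a \<in> Ob C \<Longrightarrow> \<one> a \<in> hom C a a"
    and comp_closed: "f \<in> hom C a b \<Longrightarrow> g \<in> hom C b c \<Longrightarrow> g \<cdot> f \<in> hom C a c"
    and ide_left: "f \<in> hom C a b \<Longrightarrow> \<one> b \<cdot> f = f"
    and ide_right: "f \<in> hom C a b \<Longrightarrow> f \<cdot> \<one> a = f"
    and comp_assoc: "f \<in> hom C a b \<Longrightarrow> g \<in> hom C b c \<Longrightarrow> h \<in> hom C c d \<Longrightarrow>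
      (h \<cdot> g) \<cdot> f = h \<cdot> (g \<cdot> f)"

definition monic :: "('o, 'm, 'x) category_scheme \<Rightarrow> 'm \<Rightarrow> bool" where
  "monic C m \<longleftrightarrow> m \<in> Arr C \<and>
    (\<forall>x g h. g \<in> hom C x (Dom C m) \<and> h \<in> hom C x (Dom C m) \<and>
      m \<cdot>\<^bsub>C\<^esub> g = m \<cdot>\<^bsub>C\<^esub> h \<longrightarrow> g = h)"

definition inverse_arrows :: "('o, 'm, 'x) category_scheme \<Rightarrow> 'm \<Rightarrow> 'm \<Rightarrow> bool" where
  "inverse_arrows C f g \<longleftrightarrow> f \<in> Arr C \<and> g \<in> hom C (Cod C f) (Dom C f) \<and>
    g \<cdot>\<^bsub>C\<^esub> f = \<one>\<^bsub>C\<^esub> (Dom C f) \<and> f \<cdot>\<^bsub>C\<^esub> g = \<one>\<^bsub>C\<^esub> (Cod C f)"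

definition iso :: "('o, 'm, 'x) category_scheme \<Rightarrow> 'm \<Rightarrow> bool" where
  "iso C f \<longleftrightarrow> (\<exists>g. inverse_arrows C f g)"

definition inverse_arrow :: "('o, 'm, 'x) category_scheme \<Rightarrow> 'm \<Rightarrow> 'm" where
  "inverse_arrow C f = (THE g. inverse_arrows C f g)"

text \<open>\<open>is_equalizer C f g e q\<close>: the arrow \<open>q\<close> from \<open>e\<close> is an equalizer of the parallel pair
  \<open>f\<close>, \<open>g\<close>.\<close>

definition is_equalizer ::
    "('o, 'm, 'x) category_scheme \<Rightarrow> 'm \<Rightarrow> 'm \<Rightarrow> 'o \<Rightarrow> 'm \<Rightarrow> bool" where
  "is_equalizer C f g e q \<longleftrightarrow>
    f \<in> Arr C \<and> g \<in> hom C (Dom C f) (Cod C f) \<and>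
    q \<in> hom C e (Dom C f) \<and> f \<cdot>\<^bsub>C\<^esub> q = g \<cdot>\<^bsub>C\<^esub> q \<and>
    (\<forall>x h. h \<in> hom C x (Dom C f) \<and> f \<cdot>\<^bsub>C\<^esub> h = g \<cdot>\<^bsub>C\<^esub> h \<longrightarrow>
      (\<exists>!k. k \<in> hom C x e \<and> q \<cdot>\<^bsub>C\<^esub> k = h))"

definition has_equalizers :: "('o, 'm, 'x) category_scheme \<Rightarrow> bool" where
  "has_equalizers C \<longleftrightarrow>
    (\<forall>a b f g. f \<in> hom C a b \<and> g \<in> hom C a b \<longrightarrow> (\<exists>e q. is_equalizer C f g e q))"


section \<open>Closed symmetric monoidal categories\<close>

record ('o, 'm) symmetric_monoidal_category = "('o, 'm) category" +
  tensor_ob :: "'o \<Rightarrow> 'o \<Rightarrow> 'o"  (infixr \<open>\<odot>\<index>\<close> 75)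
  tensor :: "'m \<Rightarrow> 'm \<Rightarrow> 'm"  (infixr \<open>\<otimes>\<index>\<close> 75)
  unit_ob :: 'o
  assoc :: "'o \<Rightarrow> 'o \<Rightarrow> 'o \<Rightarrow> 'm"
  lunit :: "'o \<Rightarrow> 'm"
  runit :: "'o \<Rightarrow> 'm"
  swap :: "'o \<Rightarrow> 'o \<Rightarrow> 'm"

locale symmetric_monoidal_category = category C
  for C :: "('o, 'm, 'x) symmetric_monoidal_category_scheme" (structure) +
  assumes tensor_ob_closed: "a \<in> Ob C \<Longrightarrow> b \<in> Ob C \<Longrightarrow> a \<odot> b \<in> Ob C"
    and tensor_closed: "f \<in> hom C a b \<Longrightarrow> g \<in> hom C c d \<Longrightarrow>
      f \<otimes> g \<in> hom C (a \<odot> c) (b \<odot> d)"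
    and tensor_ide: "a \<in> Ob C \<Longrightarrow> b \<in> Ob C \<Longrightarrow> \<one> a \<otimes> \<one> b = \<one> (a \<odot> b)"
    and tensor_comp: "f \<in> hom C a b \<Longrightarrow> g \<in> hom C b c \<Longrightarrow>
      f' \<in> hom C a' b' \<Longrightarrow> g' \<in> hom C b' c' \<Longrightarrow>
      (g \<cdot> f) \<otimes> (g' \<cdot> f') = (g \<otimes> g') \<cdot> (f \<otimes> f')"
    and unit_closed: "unit_ob C \<in> Ob C"
    and assoc_closed: "a \<in> Ob C \<Longrightarrow> b \<in> Ob C \<Longrightarrow> c \<in> Ob C \<Longrightarrow>
      assoc C a b c \<in> hom C ((a \<odot> b) \<odot> c) (a \<odot> (b \<odot> c))"
    and assoc_iso: "a \<in> Ob C \<Longrightarrow> b \<in> Ob C \<Longrightarrow> c \<in> Ob C \<Longrightarrow> iso C (assoc C a b c)"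
    and assoc_natural: "f \<in> hom C a a' \<Longrightarrow> g \<in> hom C b b' \<Longrightarrow> h \<in> hom C c c' \<Longrightarrow>
      assoc C a' b' c' \<cdot> ((f \<otimes> g) \<otimes> h) = (f \<otimes> (g \<otimes> h)) \<cdot> assoc C a b c"
    and lunit_closed: "a \<in> Ob C \<Longrightarrow> lunit C a \<in> hom C (unit_ob C \<odot> a) a"
    and lunit_iso: "a \<in> Ob C \<Longrightarrow> iso C (lunit C a)"
    and lunit_natural: "f \<in> hom C a b \<Longrightarrow>
      lunit C b \<cdot> (\<one> (unit_ob C) \<otimes> f) = f \<cdot> lunit C a"
    and runit_closed: "a \<in> Ob C \<Longrightarrow> runit C a \<in> hom C (a \<odot> unit_ob C) a"
    and runit_iso: "a \<in> Ob C \<Longrightarrow> iso C (runit C a)"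
    and runit_natural: "f \<in> hom C a b \<Longrightarrow>
      runit C b \<cdot> (f \<otimes> \<one> (unit_ob C)) = f \<cdot> runit C a"
    and pentagon: "a \<in> Ob C \<Longrightarrow> b \<in> Ob C \<Longrightarrow> c \<in> Ob C \<Longrightarrow> d \<in> Ob C \<Longrightarrow>
      (\<one> a \<otimes> assoc C b c d) \<cdot> assoc C a (b \<odot> c) d \<cdot> (assoc C a b c \<otimes> \<one> d)
      = assoc C a b (c \<odot> d) \<cdot> assoc C (a \<odot> b) c d"
    and triangle: "a \<in> Ob C \<Longrightarrow> b \<in> Ob C \<Longrightarrow>
      (\<one> a \<otimes> lunit C b) \<cdot> assoc C a (unit_ob C) b = runit C a \<otimes> \<one> b"
    and swap_closed: "a \<in> Ob C \<Longrightarrow> b \<in> Ob C \<Longrightarrow> swap C a b \<in> hom C (a \<odot> b) (b \<odot> a)"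
    and swap_natural: "f \<in> hom C a a' \<Longrightarrow> g \<in> hom C b b' \<Longrightarrow>
      swap C a' b' \<cdot> (f \<otimes> g) = (g \<otimes> f) \<cdot> swap C a b"
    and swap_swap: "a \<in> Ob C \<Longrightarrow> b \<in> Ob C \<Longrightarrow> swap C b a \<cdot> swap C a b = \<one> (a \<odot> b)"
    and hexagon: "a \<in> Ob C \<Longrightarrow> b \<in> Ob C \<Longrightarrow> c \<in> Ob C \<Longrightarrow>
      assoc C b c a \<cdot> swap C a (b \<odot> c) \<cdot> assoc C a b c
      = (\<one> b \<otimes> swap C a c) \<cdot> assoc C b a c \<cdot> (swap C a b \<otimes> \<one> c)"

record ('o, 'm) closed_symmetric_monoidal_category =
    "('o, 'm) symmetric_monoidal_category" +
  ihom :: "'o \<Rightarrow> 'o \<Rightarrow> 'o"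
  eval :: "'o \<Rightarrow> 'o \<Rightarrow> 'm"

text \<open>\<open>unadj C y z g\<close>, for \<open>g\<close> from \<open>x\<close> to \<open>[y; z]\<close>, is the corresponding arrow from
  \<open>y \<odot> x\<close> to \<open>z\<close>. Naturality in \<open>x\<close> of the bijection required below is automatic,
  because \<open>unadj\<close> is given by evaluation.\<close>

definition unadj ::
    "('o, 'm, 'x) closed_symmetric_monoidal_category_scheme \<Rightarrow> 'o \<Rightarrow> 'o \<Rightarrow> 'm \<Rightarrow> 'm" where
  "unadj C y z g = eval C y z \<cdot>\<^bsub>C\<^esub> (\<one>\<^bsub>C\<^esub> y \<otimes>\<^bsub>C\<^esub> g)"

locale closed_symmetric_monoidal_category = symmetric_monoidal_category C
  for C :: "('o, 'm, 'x) closed_symmetric_monoidal_category_scheme" (structure) +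
  assumes ihom_closed: "y \<in> Ob C \<Longrightarrow> z \<in> Ob C \<Longrightarrow> ihom C y z \<in> Ob C"
    and eval_closed: "y \<in> Ob C \<Longrightarrow> z \<in> Ob C \<Longrightarrow>
      eval C y z \<in> hom C (y \<odot> ihom C y z) z"
    and adjunction: "x \<in> Ob C \<Longrightarrow> y \<in> Ob C \<Longrightarrow> z \<in> Ob C \<Longrightarrow>
      bij_betw (unadj C y z) (hom C x (ihom C y z)) (hom C (y \<odot> x) z)"

text \<open>\<open>adj C y x z F\<close> is the adjoint, an arrow from \<open>x\<close> to \<open>[y; z]\<close>, of the arrow \<open>F\<close>
  from \<open>y \<odot> x\<close> to \<open>z\<close>.\<close>

definition adj ::
    "('o, 'm, 'x) closed_symmetric_monoidal_category_scheme
      \<Rightarrow> 'o \<Rightarrow> 'o \<Rightarrow> 'o \<Rightarrow> 'm \<Rightarrow> 'm" where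
  "adj C y x z F = inv_into (hom C x (ihom C y z)) (unadj C y z) F"

text \<open>The arrow \<open>[y; f]\<close> from \<open>[y; a]\<close> to \<open>[y; b]\<close> for \<open>f\<close> from \<open>a\<close> to \<open>b\<close>.\<close>

definition ihom_map ::
    "('o, 'm, 'x) closed_symmetric_monoidal_category_scheme \<Rightarrow> 'o \<Rightarrow> 'm \<Rightarrow> 'm" where
  "ihom_map C y f =
    adj C y (ihom C y (Dom C f)) (Cod C f) (f \<cdot>\<^bsub>C\<^esub> eval C y (Dom C f))"


section \<open>Enriched categories\<close>

record ('a, 'o, 'm) enriched_category =
  eob :: "'a set"
  ehom :: "'a \<Rightarrow> 'a \<Rightarrow> 'o"
  ecomp :: "'a \<Rightarrow> 'a \<Rightarrow> 'a \<Rightarrow> 'm"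
  eunit :: "'a \<Rightarrow> 'm"

locale enriched_category = symmetric_monoidal_category C
  for C :: "('o, 'm, 'x) symmetric_monoidal_category_scheme" (structure) +
  fixes A :: "('a, 'o, 'm, 'y) enriched_category_scheme"
  assumes ehom_closed: "a \<in> eob A \<Longrightarrow> b \<in> eob A \<Longrightarrow> ehom A a b \<in> Ob C"
    and ecomp_closed: "a \<in> eob A \<Longrightarrow> b \<in> eob A \<Longrightarrow> c \<in> eob A \<Longrightarrow>
      ecomp A a b c \<in> hom C (ehom A b c \<odot> ehom A a b) (ehom A a c)"
    and eunit_closed: "a \<in> eob A \<Longrightarrow> eunit A a \<in> hom C (unit_ob C) (ehom A a a)"
    and ecomp_assoc: "a \<in> eob A \<Longrightarrow> b \<in> eob A \<Longrightarrow> c \<in> eob A \<Longrightarrow> d \<in> eob A \<Longrightarrow>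
      ecomp A a b d \<cdot> (ecomp A b c d \<otimes> \<one> (ehom A a b))
      = ecomp A a c d \<cdot> (\<one> (ehom A c d) \<otimes> ecomp A a b c)
          \<cdot> assoc C (ehom A c d) (ehom A b c) (ehom A a b)"
    and eunit_left: "a \<in> eob A \<Longrightarrow> b \<in> eob A \<Longrightarrow>
      ecomp A a b b \<cdot> (eunit A b \<otimes> \<one> (ehom A a b)) = lunit C (ehom A a b)"
    and eunit_right: "a \<in> eob A \<Longrightarrow> b \<in> eob A \<Longrightarrow>
      ecomp A a a b \<cdot> (\<one> (ehom A a b) \<otimes> eunit A a) = runit C (ehom A a b)"


section \<open>Left actions, shift and transfer operator\<close>

definition left_action ::
    "('o, 'm, 'x) symmetric_monoidal_category_scheme
      \<Rightarrow> 'o \<Rightarrow> 'm \<Rightarrow> 'm \<Rightarrow> 'o \<Rightarrow> 'm \<Rightarrow> bool" where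
  "left_action C T \<mu> \<iota> X \<Psi> \<longleftrightarrow>
    X \<in> Ob C \<and> \<Psi> \<in> hom C (T \<odot>\<^bsub>C\<^esub> X) X \<and>
    \<Psi> \<cdot>\<^bsub>C\<^esub> (\<iota> \<otimes>\<^bsub>C\<^esub> \<one>\<^bsub>C\<^esub> X) = lunit C X \<and>
    \<Psi> \<cdot>\<^bsub>C\<^esub> (\<one>\<^bsub>C\<^esub> T \<otimes>\<^bsub>C\<^esub> \<Psi>) \<cdot>\<^bsub>C\<^esub> assoc C T T X = \<Psi> \<cdot>\<^bsub>C\<^esub> (\<mu> \<otimes>\<^bsub>C\<^esub> \<one>\<^bsub>C\<^esub> X)"

definition action_morphism ::
    "('o, 'm, 'x) symmetric_monoidal_category_scheme
      \<Rightarrow> 'o \<Rightarrow> 'o \<Rightarrow> 'm \<Rightarrow> 'o \<Rightarrow> 'm \<Rightarrow> 'm \<Rightarrow> bool" where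
  "action_morphism C T X \<Psi> X' \<Psi>' h \<longleftrightarrow>
    h \<in> hom C X X' \<and> h \<cdot>\<^bsub>C\<^esub> \<Psi> = \<Psi>' \<cdot>\<^bsub>C\<^esub> (\<one>\<^bsub>C\<^esub> T \<otimes>\<^bsub>C\<^esub> h)"

text \<open>The arrow from \<open>X\<close> to \<open>[T; X]\<close> written \<open>F\<close> with a flat sign.\<close>

abbreviation flat ::
    "('o, 'm, 'x) closed_symmetric_monoidal_category_scheme \<Rightarrow> 'o \<Rightarrow> 'o \<Rightarrow> 'm \<Rightarrow> 'm" where
  "flat C T X F \<equiv> adj C T X X F"

text \<open>With \<open>H = [T; W]\<close>, the adjoints below are taken along the leftmost factor of
  \<open>T \<odot> (T \<odot> H)\<close>, hence the inverse associators. On elements,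
  \<open>shift (t, \<omega>) = (\<lambda>s. \<omega> (s t))\<close> and \<open>transfer (t, \<omega>) = (\<lambda>s. \<Phi> (t, \<omega> s))\<close>.\<close>

definition shift ::
    "('o, 'm, 'x) closed_symmetric_monoidal_category_scheme
      \<Rightarrow> 'o \<Rightarrow> 'm \<Rightarrow> 'o \<Rightarrow> 'm" where
  "shift C T \<mu> W =
    (let H = ihom C T W in
     adj C T (T \<odot>\<^bsub>C\<^esub> H) W
       (eval C T W \<cdot>\<^bsub>C\<^esub> (\<mu> \<otimes>\<^bsub>C\<^esub> \<one>\<^bsub>C\<^esub> H) \<cdot>\<^bsub>C\<^esub> inverse_arrow C (assoc C T T H)))"

definition transfer ::
    "('o, 'm, 'x) closed_symmetric_monoidal_category_scheme
      \<Rightarrow> 'o \<Rightarrow> 'o \<Rightarrow> 'm \<Rightarrow> 'm" where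
  "transfer C T W \<Phi> =
    (let H = ihom C T W in
     adj C T (T \<odot>\<^bsub>C\<^esub> H) W
       (\<Phi> \<cdot>\<^bsub>C\<^esub> (\<one>\<^bsub>C\<^esub> T \<otimes>\<^bsub>C\<^esub> eval C T W) \<cdot>\<^bsub>C\<^esub> assoc C T T H
          \<cdot>\<^bsub>C\<^esub> (swap C T T \<otimes>\<^bsub>C\<^esub> \<one>\<^bsub>C\<^esub> H) \<cdot>\<^bsub>C\<^esub> inverse_arrow C (assoc C T T H)))"

text \<open>\<open>(e, q)\<close> is an equalizer \<open>q\<close> from \<open>E\<^sub>\<Phi>\<close> to \<open>[T; W]\<close> for the action \<open>\<Phi>\<close> on \<open>W\<close>.\<close>

definition action_equalizer ::
    "('o, 'm, 'x) closed_symmetric_monoidal_category_scheme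
      \<Rightarrow> 'o \<Rightarrow> 'm \<Rightarrow> 'o \<Rightarrow> 'm \<Rightarrow> 'o \<Rightarrow> 'm \<Rightarrow> bool" where
  "action_equalizer C T \<mu> W \<Phi> e q \<longleftrightarrow>
    q \<in> hom C e (ihom C T W) \<and>
    is_equalizer C (flat C T (ihom C T W) (shift C T \<mu> W))
      (flat C T (ihom C T W) (transfer C T W \<Phi>)) e q"

text \<open>\<open>s\<close> is a restriction of both shift and transfer operator along \<open>q\<close>.\<close>

definition restricted_shift ::
    "('o, 'm, 'x) closed_symmetric_monoidal_category_scheme
      \<Rightarrow> 'o \<Rightarrow> 'm \<Rightarrow> 'o \<Rightarrow> 'm \<Rightarrow> 'o \<Rightarrow> 'm \<Rightarrow> 'm \<Rightarrow> bool" where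
  "restricted_shift C T \<mu> W \<Phi> e q s \<longleftrightarrow>
    s \<in> hom C (T \<odot>\<^bsub>C\<^esub> e) e \<and>
    q \<cdot>\<^bsub>C\<^esub> s = shift C T \<mu> W \<cdot>\<^bsub>C\<^esub> (\<one>\<^bsub>C\<^esub> T \<otimes>\<^bsub>C\<^esub> q) \<and>
    q \<cdot>\<^bsub>C\<^esub> s = transfer C T W \<Phi> \<cdot>\<^bsub>C\<^esub> (\<one>\<^bsub>C\<^esub> T \<otimes>\<^bsub>C\<^esub> q)"

end

theory Submission
  imports Defs
begin

text \<open>On elements, the equalizer consists of those trajectories \<open>\<omega>\<close> in \<open>[T; \<Omega>]\<close> with
  \<open>\<omega> (s t) = \<Phi> (t, \<omega> s)\<close> for all \<open>s\<close> and \<open>t\<close>. By adjointness, an arrow \<open>h\<close> into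
  \<open>[T; \<Omega>]\<close> equalizes the two adjoints iff shift and transfer operator agree on \<open>T \<otimes> h\<close>
  (\<open>adj_comp_eq_iff\<close>), which gives the equalizer a universal property free of adjoints.

  Both operators are compatible with the multiplication of \<open>T\<close> (\<open>shift_multiplicative\<close>,
  \<open>transfer_multiplicative\<close>). For two such operators \<open>\<alpha>\<close> and \<open>\<beta>\<close> agreeing on \<open>T \<otimes> q\<close>,
  acting by \<open>t\<close> and then by \<open>r\<close> is acting by \<open>r t\<close>, so that \<open>\<alpha>\<close> and \<open>\<beta>\<close> also agree on
  the image under the action (\<open>multiplicative_agree\<close>). Hence \<open>\<alpha> \<cdot> (T \<otimes> q)\<close> factors
  uniquely through \<open>q\<close>. As \<open>q\<close> is monic, the factorization inherits the action laws of
  the shift (\<open>left_action_restrict\<close>). For a morphism \<open>f\<close> of actions, \<open>[T; f]\<close> commutes with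
  both operators, hence maps one equalizer into the other (\<open>action_morphism_lift\<close>).

  The symmetry enters only through the transfer operator. Its compatibility with the
  multiplication rests on \<open>exchange_tensor\<close>, a form of the hexagon. The unit law of the
  transfer operator is not needed.\<close>

section \<open>Arrow calculus\<close>

context category
begin

text \<open>Hom-set membership is resolved into carrier, domain and codomain, so that the
  simplifier can compute types of composites and discharge side conditions.\<close>

lemma hom_iff: "f \<in> hom C a b \<longleftrightarrow> f \<in> Arr C \<and> Dom C f = a \<and> Cod C f = b"
  by (simp add: hom_def)

lemma arr_types [simp]:
  "f \<in> Arr C \<Longrightarrow> Dom C f \<in> Ob C"
  "f \<in> Arr C \<Longrightarrow> Cod C f \<in> Ob C"
  "a \<in> Ob C \<Longrightarrow> \<one> a \<in> Arr C"
  "a \<in> Ob C \<Longrightarrow> Dom C (\<one> a) = a"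
  "a \<in> Ob C \<Longrightarrow> Cod C (\<one> a) = a"
  using dom_closed cod_closed ide_closed by (auto simp: hom_iff)

lemma comp_types [simp]:
  assumes "f \<in> Arr C" "g \<in> Arr C" "Cod C f = Dom C g"
  shows "g \<cdot> f \<in> Arr C" "Dom C (g \<cdot> f) = Dom C f" "Cod C (g \<cdot> f) = Cod C g"
  using comp_closed[of f "Dom C f" "Cod C f" g "Cod C g"] assms by (auto simp: hom_iff)

lemma comp_ide [simp]:
  "f \<in> Arr C \<Longrightarrow> Cod C f = b \<Longrightarrow> \<one> b \<cdot> f = f"
  "f \<in> Arr C \<Longrightarrow> Dom C f = a \<Longrightarrow> f \<cdot> \<one> a = f"
  using ide_left ide_right by (auto simp: hom_iff)

lemma assoc_comp:
  assumes "f \<in> Arr C" "g \<in> Arr C" "h \<in> Arr C" "Cod C f = Dom C g" "Cod C g = Dom C h"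
  shows "(h \<cdot> g) \<cdot> f = h \<cdot> (g \<cdot> f)"
  using comp_assoc assms by (auto simp: hom_iff)

text \<open>Lifts an equation between composites to one that rewrites inside a longer composite
  associated to the right.\<close>

lemma comp_eq_extend:
  assumes "g \<cdot> h = k" "h \<in> Arr C" "g \<in> Arr C" "Cod C h = Dom C g"
    and "z \<in> Arr C" "Cod C z = Dom C h"
  shows "g \<cdot> (h \<cdot> z) = k \<cdot> z"
  using assms assoc_comp by metis

lemma inverse_arrows_unique:
  assumes "inverse_arrows C f g" "inverse_arrows C f h"
  shows "g = h"
proof -
  have "g = (h \<cdot> f) \<cdot> g"
    using assms by (simp add: inverse_arrows_def hom_iff)
  also have "\<dots> = h \<cdot> (f \<cdot> g)"
    using assms by (intro assoc_comp) (auto simp: inverse_arrows_def hom_iff)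
  also have "\<dots> = h"
    using assms by (simp add: inverse_arrows_def hom_iff)
  finally show ?thesis .
qed

lemma inverse_arrows_inverse_arrow:
  assumes "iso C f"
  shows "inverse_arrows C f (inverse_arrow C f)"
  using assms inverse_arrows_unique unfolding iso_def inverse_arrow_def by (metis theI)

lemma iso_cancel_right:
  assumes "iso C f" and eq: "g \<cdot> f = h \<cdot> f"
    and t: "g \<in> Arr C" "h \<in> Arr C" "Dom C g = Cod C f" "Dom C h = Cod C f"
  shows "g = h"
proof -
  obtain k where k: "f \<in> Arr C" "k \<in> Arr C" "Dom C k = Cod C f" "Cod C k = Dom C f"
      "f \<cdot> k = \<one> (Cod C f)"
    using assms(1) by (auto simp: iso_def inverse_arrows_def hom_iff)
  have "(g \<cdot> f) \<cdot> k = (h \<cdot> f) \<cdot> k" by (simp add: eq)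
  then show ?thesis using k t by (simp add: assoc_comp)
qed

lemma is_equalizer_monic:
  assumes "is_equalizer C f g e q"
  shows "monic C q"
  unfolding monic_def
proof (intro conjI allI impI)
  show "q \<in> Arr C" using assms by (simp add: is_equalizer_def hom_iff)
  fix x k l
  assume A: "k \<in> hom C x (Dom C q) \<and> l \<in> hom C x (Dom C q) \<and> q \<cdot> k = q \<cdot> l"
  have q: "f \<in> Arr C" "g \<in> Arr C" "Dom C g = Dom C f" "Cod C g = Cod C f"
      "q \<in> Arr C" "Dom C q = e" "Cod C q = Dom C f" "f \<cdot> q = g \<cdot> q"
    using assms by (auto simp: is_equalizer_def hom_iff)
  have "f \<cdot> (q \<cdot> k) = g \<cdot> (q \<cdot> k)"
    using A q by (simp add: hom_iff assoc_comp[symmetric])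
  moreover have "q \<cdot> k \<in> hom C x (Dom C f)"
    using A q by (simp add: hom_iff)
  ultimately have "\<exists>!m. m \<in> hom C x e \<and> q \<cdot> m = q \<cdot> k"
    using assms by (simp add: is_equalizer_def)
  then show "k = l" using A q by metis
qed

end


section \<open>Tensor calculus\<close>

context symmetric_monoidal_category
begin

lemma tensor_types [simp]:
  "a \<in> Ob C \<Longrightarrow> b \<in> Ob C \<Longrightarrow> a \<odot> b \<in> Ob C"
  "f \<in> Arr C \<Longrightarrow> g \<in> Arr C \<Longrightarrow> f \<otimes> g \<in> Arr C"
  "f \<in> Arr C \<Longrightarrow> g \<in> Arr C \<Longrightarrow> Dom C (f \<otimes> g) = Dom C f \<odot> Dom C g"
  "f \<in> Arr C \<Longrightarrow> g \<in> Arr C \<Longrightarrow> Cod C (f \<otimes> g) = Cod C f \<odot> Cod C g"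
  using tensor_ob_closed tensor_closed by (auto simp: hom_iff)

lemma assoc_types [simp]:
  assumes "a \<in> Ob C" "b \<in> Ob C" "c \<in> Ob C"
  shows "assoc C a b c \<in> Arr C" "Dom C (assoc C a b c) = (a \<odot> b) \<odot> c"
    "Cod C (assoc C a b c) = a \<odot> (b \<odot> c)"
  using assoc_closed[OF assms] by (auto simp: hom_iff)

lemma unit_types [simp]:
  "unit_ob C \<in> Ob C"
  "a \<in> Ob C \<Longrightarrow> lunit C a \<in> Arr C"
  "a \<in> Ob C \<Longrightarrow> Dom C (lunit C a) = unit_ob C \<odot> a"
  "a \<in> Ob C \<Longrightarrow> Cod C (lunit C a) = a"
  "a \<in> Ob C \<Longrightarrow> runit C a \<in> Arr C"
  "a \<in> Ob C \<Longrightarrow> Dom C (runit C a) = a \<odot> unit_ob C"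
  "a \<in> Ob C \<Longrightarrow> Cod C (runit C a) = a"
  using unit_closed lunit_closed runit_closed by (auto simp: hom_iff)

lemma swap_types [simp]:
  assumes "a \<in> Ob C" "b \<in> Ob C"
  shows "swap C a b \<in> Arr C" "Dom C (swap C a b) = a \<odot> b" "Cod C (swap C a b) = b \<odot> a"
  using swap_closed[OF assms] by (auto simp: hom_iff)

declare tensor_ide [simp]

lemma tensor_comp_arr:
  assumes "f \<in> Arr C" "g \<in> Arr C" "Cod C f = Dom C g"
    and "f' \<in> Arr C" "g' \<in> Arr C" "Cod C f' = Dom C g'"
  shows "(g \<otimes> g') \<cdot> (f \<otimes> f') = (g \<cdot> f) \<otimes> (g' \<cdot> f')"
  using tensor_comp assms by (auto simp: hom_iff)

lemma whisker_left:
  assumes "a \<in> Ob C" "f \<in> Arr C" "g \<in> Arr C" "Cod C f = Dom C g"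
  shows "\<one> a \<otimes> (g \<cdot> f) = (\<one> a \<otimes> g) \<cdot> (\<one> a \<otimes> f)"
  using assms by (simp add: tensor_comp_arr)

lemma whisker_right:
  assumes "a \<in> Ob C" "f \<in> Arr C" "g \<in> Arr C" "Cod C f = Dom C g"
  shows "(g \<cdot> f) \<otimes> \<one> a = (g \<otimes> \<one> a) \<cdot> (f \<otimes> \<one> a)"
  using assms by (simp add: tensor_comp_arr)

lemma interchange:
  assumes "f \<in> Arr C" "Dom C f = a" "g \<in> Arr C" "Cod C g = d"
  shows "(f \<otimes> \<one> d) \<cdot> (\<one> a \<otimes> g) = (\<one> (Cod C f) \<otimes> g) \<cdot> (f \<otimes> \<one> (Dom C g))"
  using assms by (auto simp: tensor_comp_arr)

lemma assoc_natural_right: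
  assumes "f \<in> Arr C" "g \<in> Arr C" "h \<in> Arr C" "Cod C f = a" "Cod C g = b" "Cod C h = c"
  shows "assoc C a b c \<cdot> ((f \<otimes> g) \<otimes> h)
    = (f \<otimes> (g \<otimes> h)) \<cdot> assoc C (Dom C f) (Dom C g) (Dom C h)"
  using assoc_natural assms by (auto simp: hom_iff)

lemma assoc_natural_left:
  assumes "f \<in> Arr C" "g \<in> Arr C" "h \<in> Arr C" "Dom C f = a" "Dom C g = b" "Dom C h = c"
  shows "(f \<otimes> (g \<otimes> h)) \<cdot> assoc C a b c
    = assoc C (Cod C f) (Cod C g) (Cod C h) \<cdot> ((f \<otimes> g) \<otimes> h)"
  using assoc_natural assms by (auto simp: hom_iff)

lemma iso_whisker_right:
  assumes "iso C f" "a \<in> Ob C"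
  shows "iso C (f \<otimes> \<one> a)"
proof -
  obtain g where "inverse_arrows C f g" using assms by (auto simp: iso_def)
  then have "inverse_arrows C (f \<otimes> \<one> a) (g \<otimes> \<one> a)"
    using assms by (auto simp: inverse_arrows_def hom_iff tensor_comp_arr)
  then show ?thesis by (auto simp: iso_def)
qed

text \<open>An arrow out of \<open>a \<odot> ((b \<odot> c) \<odot> x)\<close> is determined by its composite with the
  reassociation from \<open>((a \<odot> b) \<odot> c) \<odot> x\<close>, the corner at which the pentagon starts.\<close>

lemma pentagon_corner_cancel:
  assumes o: "a \<in> Ob C" "b \<in> Ob C" "c \<in> Ob C" "x \<in> Ob C"
    and t: "f \<in> Arr C" "g \<in> Arr C" "Dom C f = a \<odot> ((b \<odot> c) \<odot> x)"
      "Dom C g = a \<odot> ((b \<odot> c) \<odot> x)"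
    and eq: "f \<cdot> assoc C a (b \<odot> c) x \<cdot> (assoc C a b c \<otimes> \<one> x)
      = g \<cdot> assoc C a (b \<odot> c) x \<cdot> (assoc C a b c \<otimes> \<one> x)"
  shows "f = g"
proof (rule iso_cancel_right)
  show "iso C (assoc C a (b \<odot> c) x)" using o by (simp add: assoc_iso)
  show "f \<cdot> assoc C a (b \<odot> c) x = g \<cdot> assoc C a (b \<odot> c) x"
  proof (rule iso_cancel_right)
    show "iso C (assoc C a b c \<otimes> \<one> x)" using o by (simp add: assoc_iso iso_whisker_right)
  qed (use o t eq in \<open>simp_all add: assoc_comp\<close>)
qed (use o t in simp_all)

abbreviation assoc_inv :: "'o \<Rightarrow> 'o \<Rightarrow> 'o \<Rightarrow> 'm" where
  "assoc_inv a b c \<equiv> inverse_arrow C (assoc C a b c)"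

lemma assoc_inv [simp]:
  assumes "a \<in> Ob C" "b \<in> Ob C" "c \<in> Ob C"
  shows "assoc_inv a b c \<in> Arr C" "Dom C (assoc_inv a b c) = a \<odot> (b \<odot> c)"
    "Cod C (assoc_inv a b c) = (a \<odot> b) \<odot> c"
    "assoc_inv a b c \<cdot> assoc C a b c = \<one> ((a \<odot> b) \<odot> c)"
    "assoc C a b c \<cdot> assoc_inv a b c = \<one> (a \<odot> (b \<odot> c))"
  using inverse_arrows_inverse_arrow[OF assoc_iso[OF assms]] assms
  by (simp_all add: inverse_arrows_def hom_iff)

text \<open>The arrow \<open>a \<odot> (b \<odot> x) \<rightarrow> b \<odot> (a \<odot> x)\<close> exchanging the first two factors.\<close>

definition exchange :: "'o \<Rightarrow> 'o \<Rightarrow> 'o \<Rightarrow> 'm" where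
  "exchange a b x = assoc C b a x \<cdot> (swap C a b \<otimes> \<one> x) \<cdot> assoc_inv a b x"

lemma exchange_types [simp]:
  assumes "a \<in> Ob C" "b \<in> Ob C" "x \<in> Ob C"
  shows "exchange a b x \<in> Arr C" "Dom C (exchange a b x) = a \<odot> (b \<odot> x)"
    "Cod C (exchange a b x) = b \<odot> (a \<odot> x)"
  using assms by (simp_all add: exchange_def)

lemma exchange_assoc:
  assumes "a \<in> Ob C" "b \<in> Ob C" "x \<in> Ob C"
  shows "exchange a b x \<cdot> assoc C a b x = assoc C b a x \<cdot> (swap C a b \<otimes> \<one> x)"
  using assms by (simp add: exchange_def assoc_comp)

lemma exchange_natural:
  assumes "f \<in> hom C a a'" "g \<in> hom C b b'" "h \<in> hom C x x'"
  shows "exchange a' b' x' \<cdot> (f \<otimes> (g \<otimes> h)) = (g \<otimes> (f \<otimes> h)) \<cdot> exchange a b x"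
proof -
  have t: "f \<in> Arr C" "Dom C f = a" "Cod C f = a'" "g \<in> Arr C" "Dom C g = b" "Cod C g = b'"
      "h \<in> Arr C" "Dom C h = x" "Cod C h = x'"
    using assms by (auto simp: hom_iff)
  have o: "a \<in> Ob C" "a' \<in> Ob C" "b \<in> Ob C" "b' \<in> Ob C" "x \<in> Ob C" "x' \<in> Ob C"
    using t by auto
  have swap_nat: "swap C a' b' \<cdot> (f \<otimes> g) = (g \<otimes> f) \<cdot> swap C a b"
    using assms swap_natural by blast
  have "(exchange a' b' x' \<cdot> (f \<otimes> (g \<otimes> h))) \<cdot> assoc C a b x
      = exchange a' b' x' \<cdot> ((f \<otimes> (g \<otimes> h)) \<cdot> assoc C a b x)"
    using o t by (simp add: assoc_comp)
  also have "\<dots> = (exchange a' b' x' \<cdot> assoc C a' b' x') \<cdot> ((f \<otimes> g) \<otimes> h)"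
    using o t by (simp add: assoc_natural_right assoc_comp)
  also have "\<dots> = assoc C b' a' x' \<cdot> ((swap C a' b' \<otimes> \<one> x') \<cdot> ((f \<otimes> g) \<otimes> h))"
    using o t by (simp add: exchange_assoc assoc_comp)
  also have "\<dots> = assoc C b' a' x' \<cdot> (((g \<otimes> f) \<otimes> h) \<cdot> (swap C a b \<otimes> \<one> x))"
    using o t by (simp add: tensor_comp_arr swap_nat)
  also have "\<dots> = (g \<otimes> (f \<otimes> h)) \<cdot> (assoc C b a x \<cdot> (swap C a b \<otimes> \<one> x))"
    using o t by (simp add: assoc_comp comp_eq_extend[OF assoc_natural_right])
  also have "\<dots> = ((g \<otimes> (f \<otimes> h)) \<cdot> exchange a b x) \<cdot> assoc C a b x"
    using o t by (simp add: exchange_assoc assoc_comp)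
  finally show ?thesis
    using o t by - (rule iso_cancel_right[OF assoc_iso[OF o(1,3,5)]], simp_all)
qed

text \<open>Moving \<open>a\<close> past \<open>b \<odot> c\<close> is moving it past \<open>b\<close> and then past \<open>c\<close>: the hexagon
  tensored with \<open>x\<close>, with three pentagons to rebracket.\<close>

lemma exchange_tensor:
  assumes o: "a \<in> Ob C" "b \<in> Ob C" "c \<in> Ob C" "x \<in> Ob C"
  shows "assoc C b c (a \<odot> x) \<cdot> exchange a (b \<odot> c) x
    = (\<one> b \<otimes> exchange a c x) \<cdot> exchange a b (c \<odot> x) \<cdot> (\<one> a \<otimes> assoc C b c x)"
proof (rule pentagon_corner_cancel[OF o])
  have "(assoc C b c (a \<odot> x) \<cdot> exchange a (b \<odot> c) x)
        \<cdot> assoc C a (b \<odot> c) x \<cdot> (assoc C a b c \<otimes> \<one> x)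
      = (assoc C b c (a \<odot> x) \<cdot> assoc C (b \<odot> c) a x)
        \<cdot> ((swap C a (b \<odot> c) \<cdot> assoc C a b c) \<otimes> \<one> x)"
    using o by (simp add: assoc_comp whisker_right comp_eq_extend[OF exchange_assoc])
  also have "\<dots> = (\<one> b \<otimes> assoc C c a x) \<cdot> assoc C b (c \<odot> a) x
      \<cdot> ((assoc C b c a \<cdot> swap C a (b \<odot> c) \<cdot> assoc C a b c) \<otimes> \<one> x)"
    using o by (simp add: pentagon[symmetric] assoc_comp whisker_right)
  also have "\<dots> = (\<one> b \<otimes> assoc C c a x) \<cdot> (assoc C b (c \<odot> a) x
      \<cdot> ((\<one> b \<otimes> swap C a c) \<otimes> \<one> x)) \<cdot> (assoc C b a c \<otimes> \<one> x)
      \<cdot> ((swap C a b \<otimes> \<one> c) \<otimes> \<one> x)"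
    using o by (simp add: hexagon assoc_comp whisker_right)
  also have "\<dots> = ((\<one> b \<otimes> assoc C c a x) \<cdot> (\<one> b \<otimes> (swap C a c \<otimes> \<one> x)))
      \<cdot> assoc C b (a \<odot> c) x \<cdot> (assoc C b a c \<otimes> \<one> x) \<cdot> ((swap C a b \<otimes> \<one> c) \<otimes> \<one> x)"
    using o by (subst assoc_natural_right) (simp_all add: assoc_comp)
  also have "\<dots> = (\<one> b \<otimes> exchange a c x) \<cdot> ((\<one> b \<otimes> assoc C a c x)
      \<cdot> assoc C b (a \<odot> c) x \<cdot> (assoc C b a c \<otimes> \<one> x)) \<cdot> ((swap C a b \<otimes> \<one> c) \<otimes> \<one> x)"
    using o by (simp add: whisker_left[symmetric] exchange_assoc[symmetric])
      (simp add: whisker_left assoc_comp)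
  also have "\<dots> = (\<one> b \<otimes> exchange a c x) \<cdot> assoc C b a (c \<odot> x)
      \<cdot> (assoc C (b \<odot> a) c x \<cdot> ((swap C a b \<otimes> \<one> c) \<otimes> \<one> x))"
    using o by (simp add: pentagon assoc_comp)
  also have "\<dots> = (\<one> b \<otimes> exchange a c x) \<cdot> (assoc C b a (c \<odot> x)
      \<cdot> (swap C a b \<otimes> \<one> (c \<odot> x))) \<cdot> assoc C (a \<odot> b) c x"
    using o by (subst assoc_natural_right) (simp_all add: assoc_comp)
  also have "\<dots> = (\<one> b \<otimes> exchange a c x) \<cdot> exchange a b (c \<odot> x)
      \<cdot> (assoc C a b (c \<odot> x) \<cdot> assoc C (a \<odot> b) c x)"
    using o by (simp add: exchange_assoc[symmetric] assoc_comp)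
  also have "\<dots> = ((\<one> b \<otimes> exchange a c x) \<cdot> exchange a b (c \<odot> x) \<cdot> (\<one> a \<otimes> assoc C b c x))
      \<cdot> assoc C a (b \<odot> c) x \<cdot> (assoc C a b c \<otimes> \<one> x)"
    using o by (simp add: pentagon[symmetric] assoc_comp)
  finally show "(assoc C b c (a \<odot> x) \<cdot> exchange a (b \<odot> c) x)
        \<cdot> assoc C a (b \<odot> c) x \<cdot> (assoc C a b c \<otimes> \<one> x)
      = ((\<one> b \<otimes> exchange a c x) \<cdot> exchange a b (c \<odot> x) \<cdot> (\<one> a \<otimes> assoc C b c x))
        \<cdot> assoc C a (b \<odot> c) x \<cdot> (assoc C a b c \<otimes> \<one> x)" .
qed (use o in simp_all)

end


section \<open>Adjoints and evaluation\<close>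

context closed_symmetric_monoidal_category
begin

lemma ihom_types [simp]:
  "y \<in> Ob C \<Longrightarrow> z \<in> Ob C \<Longrightarrow> ihom C y z \<in> Ob C"
  "y \<in> Ob C \<Longrightarrow> z \<in> Ob C \<Longrightarrow> eval C y z \<in> Arr C"
  "y \<in> Ob C \<Longrightarrow> z \<in> Ob C \<Longrightarrow> Dom C (eval C y z) = y \<odot> ihom C y z"
  "y \<in> Ob C \<Longrightarrow> z \<in> Ob C \<Longrightarrow> Cod C (eval C y z) = z"
  using ihom_closed eval_closed by (auto simp: hom_iff)

lemma adj_eval:
  assumes "x \<in> Ob C" "y \<in> Ob C" "z \<in> Ob C" "F \<in> hom C (y \<odot> x) z"
  shows "adj C y x z F \<in> hom C x (ihom C y z)"
    and "eval C y z \<cdot> (\<one> y \<otimes> adj C y x z F) = F"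
proof -
  have F: "F \<in> unadj C y z ` hom C x (ihom C y z)"
    using adjunction[OF assms(1-3)] assms(4) by (simp add: bij_betw_def)
  show "adj C y x z F \<in> hom C x (ihom C y z)"
    using inv_into_into[OF F] by (simp add: adj_def)
  show "eval C y z \<cdot> (\<one> y \<otimes> adj C y x z F) = F"
    using f_inv_into_f[OF F] by (simp add: adj_def unadj_def)
qed

lemma eval_ext:
  assumes "y \<in> Ob C" "z \<in> Ob C" "g \<in> hom C x (ihom C y z)" "h \<in> hom C x (ihom C y z)"
    and "eval C y z \<cdot> (\<one> y \<otimes> g) = eval C y z \<cdot> (\<one> y \<otimes> h)"
  shows "g = h"
proof -
  have "x \<in> Ob C" using assms(3) by (auto simp: hom_iff)
  then have "inj_on (unadj C y z) (hom C x (ihom C y z))"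
    using adjunction assms by (auto simp: bij_betw_def)
  then show ?thesis using assms by (auto simp: inj_on_def unadj_def)
qed

lemma ihom_map_eval:
  assumes "y \<in> Ob C" "f \<in> hom C a b"
  shows "ihom_map C y f \<in> hom C (ihom C y a) (ihom C y b)"
    and "eval C y b \<cdot> (\<one> y \<otimes> ihom_map C y f) = f \<cdot> eval C y a"
proof -
  have t: "f \<in> Arr C" "Dom C f = a" "Cod C f = b" using assms by (auto simp: hom_iff)
  have o: "a \<in> Ob C" "b \<in> Ob C" using t by auto
  have F: "f \<cdot> eval C y a \<in> hom C (y \<odot> ihom C y a) b"
    using o t assms(1) by (simp add: hom_iff)
  show "ihom_map C y f \<in> hom C (ihom C y a) (ihom C y b)"
    and "eval C y b \<cdot> (\<one> y \<otimes> ihom_map C y f) = f \<cdot> eval C y a"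
    using adj_eval[OF _ assms(1) o(2) F] o t assms(1) by (simp_all add: ihom_map_def)
qed

text \<open>Composing an adjoint with \<open>h\<close> corresponds to precomposing with \<open>y \<otimes> h\<close>, so two
  adjoints agree after \<open>h\<close> iff the original arrows agree on \<open>y \<otimes> h\<close>.\<close>

lemma adj_comp_eq_iff:
  assumes "x \<in> Ob C" "y \<in> Ob C" "z \<in> Ob C"
    and F: "F \<in> hom C (y \<odot> x) z" and G: "G \<in> hom C (y \<odot> x) z" and h: "h \<in> hom C w x"
  shows "adj C y x z F \<cdot> h = adj C y x z G \<cdot> h \<longleftrightarrow> F \<cdot> (\<one> y \<otimes> h) = G \<cdot> (\<one> y \<otimes> h)"
proof -
  have restrict: "eval C y z \<cdot> (\<one> y \<otimes> (adj C y x z K \<cdot> h)) = K \<cdot> (\<one> y \<otimes> h)"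
    and closed: "adj C y x z K \<cdot> h \<in> hom C w (ihom C y z)"
    if K: "K \<in> hom C (y \<odot> x) z" for K
    using adj_eval[OF assms(1-3) K] h assms(1-3)
    by (auto simp: hom_iff whisker_left comp_eq_extend)
  show ?thesis
    using eval_ext[OF assms(2,3) closed[OF F] closed[OF G]] restrict[OF F] restrict[OF G]
    by metis
qed

end


section \<open>Shift and transfer operator as actions on the internal hom\<close>

text \<open>A monoid object \<open>(T, \<mu>, \<iota>)\<close> with only the right unit law, which is the
  one that makes the shift unital.\<close>

locale internal_monoid = closed_symmetric_monoidal_category C
  for C :: "('o, 'm, 'x) closed_symmetric_monoidal_category_scheme" (structure) +
  fixes T :: 'o and \<mu> \<iota> :: 'm
  assumes T_ob [simp]: "T \<in> Ob C"
    and mult_closed: "\<mu> \<in> hom C (T \<odot> T) T"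
    and unit_arr_closed: "\<iota> \<in> hom C (unit_ob C) T"
    and mult_assoc: "\<mu> \<cdot> (\<mu> \<otimes> \<one> T) = \<mu> \<cdot> (\<one> T \<otimes> \<mu>) \<cdot> assoc C T T T"
    and mult_unit_right: "\<mu> \<cdot> (\<one> T \<otimes> \<iota>) = runit C T"
begin

lemma mult_types [simp]: "\<mu> \<in> Arr C" "Dom C \<mu> = T \<odot> T" "Cod C \<mu> = T"
  using mult_closed by (auto simp: hom_iff)

lemma unit_arr_types [simp]: "\<iota> \<in> Arr C" "Dom C \<iota> = unit_ob C" "Cod C \<iota> = T"
  using unit_arr_closed by (auto simp: hom_iff)

text \<open>The multiplicative half of a left action.\<close>

definition multiplicative :: "'o \<Rightarrow> 'm \<Rightarrow> bool" where
  "multiplicative X \<alpha> \<longleftrightarrow> \<alpha> \<in> hom C (T \<odot> X) X \<and>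
    \<alpha> \<cdot> (\<one> T \<otimes> \<alpha>) \<cdot> assoc C T T X = \<alpha> \<cdot> (\<mu> \<otimes> \<one> X)"

lemma shift_eval:
  assumes W: "W \<in> Ob C"
  defines "H \<equiv> ihom C T W"
  shows "shift C T \<mu> W \<in> hom C (T \<odot> H) H"
    and "eval C T W \<cdot> (\<one> T \<otimes> shift C T \<mu> W) \<cdot> assoc C T T H = eval C T W \<cdot> (\<mu> \<otimes> \<one> H)"
proof -
  have H [simp]: "H \<in> Ob C" using W by (simp add: H_def)
  have ev [simp]: "eval C T W \<in> Arr C" "Dom C (eval C T W) = T \<odot> H" "Cod C (eval C T W) = W"
    using W by (simp_all add: H_def)
  let ?F = "eval C T W \<cdot> (\<mu> \<otimes> \<one> H) \<cdot> assoc_inv T T H"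
  have F: "?F \<in> hom C (T \<odot> (T \<odot> H)) W" by (simp add: hom_iff)
  have sh: "shift C T \<mu> W = adj C T (T \<odot> H) W ?F"
    by (simp add: shift_def H_def Let_def)
  show "shift C T \<mu> W \<in> hom C (T \<odot> H) H"
    using adj_eval(1)[OF _ T_ob W F] unfolding sh H_def[symmetric] by simp
  then have t: "shift C T \<mu> W \<in> Arr C" "Dom C (shift C T \<mu> W) = T \<odot> H"
      "Cod C (shift C T \<mu> W) = H"
    by (auto simp: hom_iff)
  have e: "eval C T W \<cdot> (\<one> T \<otimes> shift C T \<mu> W) = ?F"
    using adj_eval(2)[OF _ T_ob W F] unfolding sh by simp
  show "eval C T W \<cdot> (\<one> T \<otimes> shift C T \<mu> W) \<cdot> assoc C T T H = eval C T W \<cdot> (\<mu> \<otimes> \<one> H)"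
    using t by (simp add: comp_eq_extend[OF e] assoc_comp)
qed

lemma shift_types [simp]:
  assumes "W \<in> Ob C"
  shows "shift C T \<mu> W \<in> Arr C" "Dom C (shift C T \<mu> W) = T \<odot> ihom C T W"
    "Cod C (shift C T \<mu> W) = ihom C T W"
  using shift_eval(1)[OF assms] by (auto simp: hom_iff)

text \<open>On elements, both sides send \<open>(r, t, \<omega>)\<close> to \<open>\<lambda>s. \<omega> (s r t)\<close>.\<close>

lemma shift_multiplicative:
  assumes W: "W \<in> Ob C"
  shows "multiplicative (ihom C T W) (shift C T \<mu> W)"
proof -
  define H where "H = ihom C T W"
  define S where "S = shift C T \<mu> W"
  define ev where "ev = eval C T W"
  have t [simp]: "H \<in> Ob C" "S \<in> Arr C" "Dom C S = T \<odot> H" "Cod C S = H"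
      "ev \<in> Arr C" "Dom C ev = T \<odot> H" "Cod C ev = W"
    using W by (simp_all add: H_def S_def ev_def)
  have evS: "ev \<cdot> (\<one> T \<otimes> S) \<cdot> assoc C T T H = ev \<cdot> (\<mu> \<otimes> \<one> H)"
    using shift_eval(2)[OF W] by (simp add: H_def S_def ev_def)
  have evS_comp: "ev \<cdot> (\<one> T \<otimes> S) \<cdot> assoc C T T H \<cdot> z = ev \<cdot> (\<mu> \<otimes> \<one> H) \<cdot> z"
    if "z \<in> Arr C" "Cod C z = (T \<odot> T) \<odot> H" for z
  proof -
    have "ev \<cdot> (\<one> T \<otimes> S) \<cdot> assoc C T T H \<cdot> z = (ev \<cdot> (\<one> T \<otimes> S) \<cdot> assoc C T T H) \<cdot> z"
      using that by (simp add: assoc_comp)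
    also have "\<dots> = ev \<cdot> (\<mu> \<otimes> \<one> H) \<cdot> z"
      using that by (simp add: evS assoc_comp)
    finally show ?thesis .
  qed
  have "S \<cdot> (\<one> T \<otimes> S) \<cdot> assoc C T T H = S \<cdot> (\<mu> \<otimes> \<one> H)"
  proof (rule eval_ext[of T W _ "(T \<odot> T) \<odot> H"])
    have "ev \<cdot> (\<one> T \<otimes> (S \<cdot> (\<one> T \<otimes> S) \<cdot> assoc C T T H))
        = ev \<cdot> (\<one> T \<otimes> (S \<cdot> (\<mu> \<otimes> \<one> H)))"
    proof (rule pentagon_corner_cancel[of T T T H])
      have "(ev \<cdot> (\<one> T \<otimes> (S \<cdot> (\<one> T \<otimes> S) \<cdot> assoc C T T H)))
            \<cdot> assoc C T (T \<odot> T) H \<cdot> (assoc C T T T \<otimes> \<one> H)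
          = ev \<cdot> (\<one> T \<otimes> S) \<cdot> (\<one> T \<otimes> (\<one> T \<otimes> S)) \<cdot> ((\<one> T \<otimes> assoc C T T H)
            \<cdot> assoc C T (T \<odot> T) H \<cdot> (assoc C T T T \<otimes> \<one> H))"
        by (simp add: whisker_left assoc_comp)
      also have "\<dots> = ev \<cdot> (\<one> T \<otimes> S) \<cdot> ((\<one> T \<otimes> (\<one> T \<otimes> S)) \<cdot> assoc C T T (T \<odot> H))
          \<cdot> assoc C (T \<odot> T) T H"
        by (simp add: pentagon assoc_comp)
      also have "\<dots> = ev \<cdot> (\<one> T \<otimes> S) \<cdot> assoc C T T H \<cdot> (\<one> (T \<odot> T) \<otimes> S)
          \<cdot> assoc C (T \<odot> T) T H"
        by (simp add: assoc_natural_left assoc_comp)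
      also have "\<dots> = ev \<cdot> ((\<mu> \<otimes> \<one> H) \<cdot> (\<one> (T \<odot> T) \<otimes> S)) \<cdot> assoc C (T \<odot> T) T H"
        by (simp add: evS_comp assoc_comp)
      also have "\<dots> = ev \<cdot> (\<one> T \<otimes> S) \<cdot> ((\<mu> \<otimes> \<one> (T \<odot> H)) \<cdot> assoc C (T \<odot> T) T H)"
        by (simp add: interchange assoc_comp)
      also have "\<dots> = ev \<cdot> (\<one> T \<otimes> S) \<cdot> assoc C T T H \<cdot> ((\<mu> \<otimes> \<one> T) \<otimes> \<one> H)"
        by (simp add: assoc_natural_right)
      also have "\<dots> = ev \<cdot> ((\<mu> \<cdot> (\<mu> \<otimes> \<one> T)) \<otimes> \<one> H)"
        by (simp add: evS_comp whisker_right)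
      also have "\<dots> = ev \<cdot> (\<mu> \<otimes> \<one> H) \<cdot> ((\<one> T \<otimes> \<mu>) \<otimes> \<one> H) \<cdot> (assoc C T T T \<otimes> \<one> H)"
        by (simp add: mult_assoc whisker_right)
      also have "\<dots> = ev \<cdot> (\<one> T \<otimes> S) \<cdot> (assoc C T T H \<cdot> ((\<one> T \<otimes> \<mu>) \<otimes> \<one> H))
          \<cdot> (assoc C T T T \<otimes> \<one> H)"
        by (simp add: evS_comp assoc_comp)
      also have "\<dots> = (ev \<cdot> (\<one> T \<otimes> (S \<cdot> (\<mu> \<otimes> \<one> H))))
          \<cdot> assoc C T (T \<odot> T) H \<cdot> (assoc C T T T \<otimes> \<one> H)"
        by (simp add: assoc_natural_right whisker_left assoc_comp)
      finally show "(ev \<cdot> (\<one> T \<otimes> (S \<cdot> (\<one> T \<otimes> S) \<cdot> assoc C T T H)))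
            \<cdot> assoc C T (T \<odot> T) H \<cdot> (assoc C T T T \<otimes> \<one> H)
          = (ev \<cdot> (\<one> T \<otimes> (S \<cdot> (\<mu> \<otimes> \<one> H))))
            \<cdot> assoc C T (T \<odot> T) H \<cdot> (assoc C T T T \<otimes> \<one> H)" .
    qed simp_all
    then show "eval C T W \<cdot> (\<one> T \<otimes> (S \<cdot> (\<one> T \<otimes> S) \<cdot> assoc C T T H))
        = eval C T W \<cdot> (\<one> T \<otimes> (S \<cdot> (\<mu> \<otimes> \<one> H)))"
      by (simp add: ev_def)
  qed (use W in \<open>simp_all add: hom_iff H_def[symmetric]\<close>)
  then show ?thesis by (simp add: multiplicative_def hom_iff H_def[symmetric] S_def[symmetric])
qed

text \<open>The unit law uses the right unit law of \<open>\<mu>\<close>, since \<open>shift (\<iota>, \<omega>) = (\<lambda>s. \<omega> (s \<iota>))\<close>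
  on elements; the triangle identity turns the right unitor into a left one.\<close>

lemma shift_left_action:
  assumes W: "W \<in> Ob C"
  shows "left_action C T \<mu> \<iota> (ihom C T W) (shift C T \<mu> W)"
proof -
  define H where "H = ihom C T W"
  define S where "S = shift C T \<mu> W"
  define ev where "ev = eval C T W"
  have t [simp]: "H \<in> Ob C" "S \<in> Arr C" "Dom C S = T \<odot> H" "Cod C S = H"
      "ev \<in> Arr C" "Dom C ev = T \<odot> H" "Cod C ev = W"
    using W by (simp_all add: H_def S_def ev_def)
  have evS: "ev \<cdot> (\<one> T \<otimes> S) \<cdot> assoc C T T H = ev \<cdot> (\<mu> \<otimes> \<one> H)"
    using shift_eval(2)[OF W] by (simp add: H_def S_def ev_def)
  have "S \<cdot> (\<iota> \<otimes> \<one> H) = lunit C H"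
  proof (rule eval_ext[of T W _ "unit_ob C \<odot> H"])
    have "ev \<cdot> (\<one> T \<otimes> (S \<cdot> (\<iota> \<otimes> \<one> H))) = ev \<cdot> (\<one> T \<otimes> lunit C H)"
    proof (rule iso_cancel_right)
      show "iso C (assoc C T (unit_ob C) H)" by (simp add: assoc_iso)
      have "(ev \<cdot> (\<one> T \<otimes> (S \<cdot> (\<iota> \<otimes> \<one> H)))) \<cdot> assoc C T (unit_ob C) H
          = ev \<cdot> (\<one> T \<otimes> S) \<cdot> ((\<one> T \<otimes> (\<iota> \<otimes> \<one> H)) \<cdot> assoc C T (unit_ob C) H)"
        by (simp add: whisker_left assoc_comp)
      also have "\<dots> = (ev \<cdot> (\<one> T \<otimes> S) \<cdot> assoc C T T H) \<cdot> ((\<one> T \<otimes> \<iota>) \<otimes> \<one> H)"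
        by (simp add: assoc_natural_right assoc_comp)
      also have "\<dots> = ev \<cdot> ((\<mu> \<cdot> (\<one> T \<otimes> \<iota>)) \<otimes> \<one> H)"
        unfolding evS by (simp add: whisker_right assoc_comp)
      also have "\<dots> = (ev \<cdot> (\<one> T \<otimes> lunit C H)) \<cdot> assoc C T (unit_ob C) H"
        by (simp add: mult_unit_right triangle[symmetric] assoc_comp)
      finally show "(ev \<cdot> (\<one> T \<otimes> (S \<cdot> (\<iota> \<otimes> \<one> H)))) \<cdot> assoc C T (unit_ob C) H
          = (ev \<cdot> (\<one> T \<otimes> lunit C H)) \<cdot> assoc C T (unit_ob C) H" .
    qed simp_all
    then show "eval C T W \<cdot> (\<one> T \<otimes> (S \<cdot> (\<iota> \<otimes> \<one> H))) = eval C T W \<cdot> (\<one> T \<otimes> lunit C H)"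
      by (simp add: ev_def)
  qed (use W in \<open>simp_all add: hom_iff H_def[symmetric]\<close>)
  then show ?thesis
    using shift_multiplicative[OF W] W
    by (simp add: left_action_def multiplicative_def H_def S_def)
qed

lemma transfer_eval:
  assumes W: "W \<in> Ob C" and \<Phi>: "\<Phi> \<in> hom C (T \<odot> W) W"
  defines "H \<equiv> ihom C T W"
  shows "transfer C T W \<Phi> \<in> hom C (T \<odot> H) H"
    and "eval C T W \<cdot> (\<one> T \<otimes> transfer C T W \<Phi>)
      = \<Phi> \<cdot> (\<one> T \<otimes> eval C T W) \<cdot> exchange T T H"
proof -
  have F: "\<Phi> \<cdot> (\<one> T \<otimes> eval C T W) \<cdot> exchange T T H \<in> hom C (T \<odot> (T \<odot> H)) W"
    using W \<Phi> by (simp add: hom_iff H_def)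
  have tr: "transfer C T W \<Phi>
      = adj C T (T \<odot> H) W (\<Phi> \<cdot> (\<one> T \<otimes> eval C T W) \<cdot> exchange T T H)"
    by (simp add: transfer_def H_def Let_def exchange_def)
  show "transfer C T W \<Phi> \<in> hom C (T \<odot> H) H"
    using adj_eval(1)[OF _ T_ob W F] W unfolding tr H_def[symmetric] by (simp add: H_def)
  show "eval C T W \<cdot> (\<one> T \<otimes> transfer C T W \<Phi>)
      = \<Phi> \<cdot> (\<one> T \<otimes> eval C T W) \<cdot> exchange T T H"
    using adj_eval(2)[OF _ T_ob W F] W unfolding tr by (simp add: H_def)
qed

text \<open>On elements, both sides send \<open>(r, t, \<omega>)\<close> to \<open>\<lambda>s. \<Phi> (r, \<Phi> (t, \<omega> s))\<close>. The point is
  that exchanging \<open>s\<close> with the pair \<open>(r, t)\<close> is exchanging it with \<open>r\<close> and then with \<open>t\<close>.\<close>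

lemma transfer_multiplicative:
  assumes W: "W \<in> Ob C" and act: "multiplicative W \<Phi>"
  shows "multiplicative (ihom C T W) (transfer C T W \<Phi>)"
proof -
  define H where "H = ihom C T W"
  define R where "R = transfer C T W \<Phi>"
  define ev where "ev = eval C T W"
  have \<Phi>: "\<Phi> \<in> hom C (T \<odot> W) W"
    and act_eq: "\<Phi> \<cdot> (\<mu> \<otimes> \<one> W) = \<Phi> \<cdot> (\<one> T \<otimes> \<Phi>) \<cdot> assoc C T T W"
    using act by (simp_all add: multiplicative_def)
  have t [simp]: "\<Phi> \<in> Arr C" "Dom C \<Phi> = T \<odot> W" "Cod C \<Phi> = W" "H \<in> Ob C" "W \<in> Ob C"
      "R \<in> Arr C" "Dom C R = T \<odot> H" "Cod C R = H"
      "ev \<in> Arr C" "Dom C ev = T \<odot> H" "Cod C ev = W"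
    using W \<Phi> transfer_eval(1)[OF W \<Phi>] by (simp_all add: H_def R_def ev_def hom_iff)
  have evR: "ev \<cdot> (\<one> T \<otimes> R) = \<Phi> \<cdot> (\<one> T \<otimes> ev) \<cdot> exchange T T H"
    using transfer_eval(2)[OF W \<Phi>] by (simp add: H_def R_def ev_def)
  have exR: "exchange T T H \<cdot> (\<one> T \<otimes> (\<one> T \<otimes> R))
      = (\<one> T \<otimes> (\<one> T \<otimes> R)) \<cdot> exchange T T (T \<odot> H)"
    by (intro exchange_natural) (simp_all add: hom_iff)
  have ex\<mu>: "exchange T T H \<cdot> (\<one> T \<otimes> (\<mu> \<otimes> \<one> H))
      = (\<mu> \<otimes> \<one> (T \<odot> H)) \<cdot> exchange T (T \<odot> T) H"
    using exchange_natural[of "\<one> T" T T \<mu> "T \<odot> T" T "\<one> H" H H] by (simp add: hom_iff)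
  have "R \<cdot> (\<one> T \<otimes> R) \<cdot> assoc C T T H = R \<cdot> (\<mu> \<otimes> \<one> H)"
  proof (rule eval_ext[of T W _ "(T \<odot> T) \<odot> H"])
    have "ev \<cdot> (\<one> T \<otimes> (R \<cdot> (\<one> T \<otimes> R) \<cdot> assoc C T T H))
        = \<Phi> \<cdot> (\<one> T \<otimes> ev) \<cdot> (exchange T T H \<cdot> (\<one> T \<otimes> (\<one> T \<otimes> R)))
          \<cdot> (\<one> T \<otimes> assoc C T T H)"
      by (simp add: whisker_left assoc_comp comp_eq_extend[OF evR])
    also have "\<dots> = \<Phi> \<cdot> ((\<one> T \<otimes> (ev \<cdot> (\<one> T \<otimes> R))) \<cdot> exchange T T (T \<odot> H)
          \<cdot> (\<one> T \<otimes> assoc C T T H))"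
      by (simp add: exR whisker_left assoc_comp)
    also have "\<dots> = \<Phi> \<cdot> (\<one> T \<otimes> \<Phi>) \<cdot> (\<one> T \<otimes> (\<one> T \<otimes> ev)) \<cdot> ((\<one> T \<otimes> exchange T T H)
          \<cdot> exchange T T (T \<odot> H) \<cdot> (\<one> T \<otimes> assoc C T T H))"
      by (simp add: evR whisker_left assoc_comp)
    also have "\<dots> = \<Phi> \<cdot> (\<one> T \<otimes> \<Phi>) \<cdot> ((\<one> T \<otimes> (\<one> T \<otimes> ev)) \<cdot> assoc C T T (T \<odot> H))
          \<cdot> exchange T (T \<odot> T) H"
      by (simp add: exchange_tensor[symmetric] assoc_comp)
    also have "\<dots> = (\<Phi> \<cdot> (\<one> T \<otimes> \<Phi>) \<cdot> assoc C T T W) \<cdot> (\<one> (T \<odot> T) \<otimes> ev)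
          \<cdot> exchange T (T \<odot> T) H"
      by (simp add: assoc_natural_left assoc_comp)
    also have "\<dots> = \<Phi> \<cdot> ((\<mu> \<otimes> \<one> W) \<cdot> (\<one> (T \<odot> T) \<otimes> ev)) \<cdot> exchange T (T \<odot> T) H"
      by (simp add: act_eq[symmetric] assoc_comp)
    also have "\<dots> = \<Phi> \<cdot> (\<one> T \<otimes> ev) \<cdot> ((\<mu> \<otimes> \<one> (T \<odot> H)) \<cdot> exchange T (T \<odot> T) H)"
      by (simp add: interchange assoc_comp)
    also have "\<dots> = (ev \<cdot> (\<one> T \<otimes> R)) \<cdot> (\<one> T \<otimes> (\<mu> \<otimes> \<one> H))"
      by (simp add: ex\<mu>[symmetric] evR assoc_comp)
    also have "\<dots> = ev \<cdot> (\<one> T \<otimes> (R \<cdot> (\<mu> \<otimes> \<one> H)))"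
      by (simp add: whisker_left assoc_comp)
    finally show "eval C T W \<cdot> (\<one> T \<otimes> (R \<cdot> (\<one> T \<otimes> R) \<cdot> assoc C T T H))
        = eval C T W \<cdot> (\<one> T \<otimes> (R \<cdot> (\<mu> \<otimes> \<one> H)))"
      by (simp add: ev_def)
  qed (simp_all add: hom_iff H_def[symmetric])
  then show ?thesis by (simp add: multiplicative_def hom_iff H_def[symmetric] R_def[symmetric])
qed

lemma ihom_map_shift:
  assumes f: "f \<in> hom C W W'"
  shows "ihom_map C T f \<cdot> shift C T \<mu> W = shift C T \<mu> W' \<cdot> (\<one> T \<otimes> ihom_map C T f)"
proof -
  have tf [simp]: "f \<in> Arr C" "Dom C f = W" "Cod C f = W'"
    using f by (auto simp: hom_iff)
  have W [simp]: "W \<in> Ob C" "W' \<in> Ob C" using arr_types(1,2)[OF tf(1)] by simp_all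
  define H where "H = ihom C T W"
  define H' where "H' = ihom C T W'"
  define S where "S = shift C T \<mu> W"
  define S' where "S' = shift C T \<mu> W'"
  define ev where "ev = eval C T W"
  define ev' where "ev' = eval C T W'"
  define p where "p = ihom_map C T f"
  have t [simp]: "H \<in> Ob C" "S \<in> Arr C" "Dom C S = T \<odot> H" "Cod C S = H"
      "ev \<in> Arr C" "Dom C ev = T \<odot> H" "Cod C ev = W"
      "H' \<in> Ob C" "S' \<in> Arr C" "Dom C S' = T \<odot> H'" "Cod C S' = H'"
      "ev' \<in> Arr C" "Dom C ev' = T \<odot> H'" "Cod C ev' = W'"
      "p \<in> Arr C" "Dom C p = H" "Cod C p = H'"
    using ihom_map_eval(1)[OF T_ob f]
    by (simp_all add: H_def S_def ev_def H'_def S'_def ev'_def p_def hom_iff)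
  have evS: "ev \<cdot> (\<one> T \<otimes> S) \<cdot> assoc C T T H = ev \<cdot> (\<mu> \<otimes> \<one> H)"
    using shift_eval(2)[OF W(1)] by (simp add: H_def S_def ev_def)
  have evS': "ev' \<cdot> (\<one> T \<otimes> S') \<cdot> assoc C T T H' = ev' \<cdot> (\<mu> \<otimes> \<one> H')"
    using shift_eval(2)[OF W(2)] by (simp add: H'_def S'_def ev'_def)
  have evp: "ev' \<cdot> (\<one> T \<otimes> p) = f \<cdot> ev"
    using ihom_map_eval(2)[OF T_ob f] by (simp add: ev_def ev'_def p_def)
  have "p \<cdot> S = S' \<cdot> (\<one> T \<otimes> p)"
  proof (rule eval_ext[of T W' _ "T \<odot> H"])
    have "ev' \<cdot> (\<one> T \<otimes> (p \<cdot> S)) = ev' \<cdot> (\<one> T \<otimes> (S' \<cdot> (\<one> T \<otimes> p)))"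
    proof (rule iso_cancel_right)
      show "iso C (assoc C T T H)" by (simp add: assoc_iso)
      have "(ev' \<cdot> (\<one> T \<otimes> (p \<cdot> S))) \<cdot> assoc C T T H
          = f \<cdot> (ev \<cdot> (\<one> T \<otimes> S) \<cdot> assoc C T T H)"
        by (simp add: whisker_left assoc_comp comp_eq_extend[OF evp])
      also have "\<dots> = (ev' \<cdot> (\<one> T \<otimes> p)) \<cdot> (\<mu> \<otimes> \<one> H)"
        by (simp add: evS evp assoc_comp)
      also have "\<dots> = (ev' \<cdot> (\<mu> \<otimes> \<one> H')) \<cdot> (\<one> (T \<odot> T) \<otimes> p)"
        by (simp add: interchange assoc_comp)
      also have "\<dots> = ev' \<cdot> (\<one> T \<otimes> S') \<cdot> (assoc C T T H' \<cdot> ((\<one> T \<otimes> \<one> T) \<otimes> p))"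
        unfolding evS'[symmetric] by (simp add: assoc_comp)
      also have "\<dots> = (ev' \<cdot> (\<one> T \<otimes> (S' \<cdot> (\<one> T \<otimes> p)))) \<cdot> assoc C T T H"
        by (subst assoc_natural_right) (simp_all add: whisker_left assoc_comp)
      finally show "(ev' \<cdot> (\<one> T \<otimes> (p \<cdot> S))) \<cdot> assoc C T T H
          = (ev' \<cdot> (\<one> T \<otimes> (S' \<cdot> (\<one> T \<otimes> p)))) \<cdot> assoc C T T H" .
    qed simp_all
    then show "eval C T W' \<cdot> (\<one> T \<otimes> (p \<cdot> S)) = eval C T W' \<cdot> (\<one> T \<otimes> (S' \<cdot> (\<one> T \<otimes> p)))"
      by (simp add: ev'_def)
  qed (simp_all add: hom_iff H'_def[symmetric])
  then show ?thesis by (simp add: p_def S_def S'_def)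
qed

lemma ihom_map_transfer:
  assumes \<Phi>: "\<Phi> \<in> hom C (T \<odot> W) W" and \<Psi>: "\<Psi> \<in> hom C (T \<odot> W') W'"
    and f: "action_morphism C T W \<Phi> W' \<Psi> f"
  shows "ihom_map C T f \<cdot> transfer C T W \<Phi> = transfer C T W' \<Psi> \<cdot> (\<one> T \<otimes> ihom_map C T f)"
proof -
  have fh: "f \<in> hom C W W'" and f_act: "f \<cdot> \<Phi> = \<Psi> \<cdot> (\<one> T \<otimes> f)"
    using f by (simp_all add: action_morphism_def)
  have tf [simp]: "f \<in> Arr C" "Dom C f = W" "Cod C f = W'"
    using fh by (auto simp: hom_iff)
  have W [simp]: "W \<in> Ob C" "W' \<in> Ob C" using arr_types(1,2)[OF tf(1)] by simp_all
  define H where "H = ihom C T W"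
  define H' where "H' = ihom C T W'"
  define R where "R = transfer C T W \<Phi>"
  define R' where "R' = transfer C T W' \<Psi>"
  define ev where "ev = eval C T W"
  define ev' where "ev' = eval C T W'"
  define p where "p = ihom_map C T f"
  have t [simp]: "H \<in> Ob C" "R \<in> Arr C" "Dom C R = T \<odot> H" "Cod C R = H"
      "ev \<in> Arr C" "Dom C ev = T \<odot> H" "Cod C ev = W"
      "H' \<in> Ob C" "R' \<in> Arr C" "Dom C R' = T \<odot> H'" "Cod C R' = H'"
      "ev' \<in> Arr C" "Dom C ev' = T \<odot> H'" "Cod C ev' = W'"
      "p \<in> Arr C" "Dom C p = H" "Cod C p = H'"
      "\<Phi> \<in> Arr C" "Dom C \<Phi> = T \<odot> W" "Cod C \<Phi> = W"
      "\<Psi> \<in> Arr C" "Dom C \<Psi> = T \<odot> W'" "Cod C \<Psi> = W'"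
    using ihom_map_eval(1)[OF T_ob fh] \<Phi> \<Psi>
      transfer_eval(1)[OF W(1) \<Phi>] transfer_eval(1)[OF W(2) \<Psi>]
    by (simp_all add: H_def R_def ev_def H'_def R'_def ev'_def p_def hom_iff)
  have evR: "ev \<cdot> (\<one> T \<otimes> R) = \<Phi> \<cdot> (\<one> T \<otimes> ev) \<cdot> exchange T T H"
    using transfer_eval(2)[OF W(1) \<Phi>] by (simp add: H_def R_def ev_def)
  have evR': "ev' \<cdot> (\<one> T \<otimes> R') = \<Psi> \<cdot> (\<one> T \<otimes> ev') \<cdot> exchange T T H'"
    using transfer_eval(2)[OF W(2) \<Psi>] by (simp add: H'_def R'_def ev'_def)
  have evp: "ev' \<cdot> (\<one> T \<otimes> p) = f \<cdot> ev"
    using ihom_map_eval(2)[OF T_ob fh] by (simp add: ev_def ev'_def p_def)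
  have exp: "exchange T T H' \<cdot> (\<one> T \<otimes> (\<one> T \<otimes> p)) = (\<one> T \<otimes> (\<one> T \<otimes> p)) \<cdot> exchange T T H"
    by (intro exchange_natural) (simp_all add: hom_iff)
  have "p \<cdot> R = R' \<cdot> (\<one> T \<otimes> p)"
  proof (rule eval_ext[of T W' _ "T \<odot> H"])
    have "ev' \<cdot> (\<one> T \<otimes> (p \<cdot> R)) = f \<cdot> (ev \<cdot> (\<one> T \<otimes> R))"
      by (simp add: whisker_left comp_eq_extend[OF evp] assoc_comp)
    also have "\<dots> = \<Psi> \<cdot> (\<one> T \<otimes> (f \<cdot> ev)) \<cdot> exchange T T H"
      by (simp add: evR comp_eq_extend[OF f_act] whisker_left assoc_comp)
    also have "\<dots> = \<Psi> \<cdot> (\<one> T \<otimes> ev') \<cdot> (exchange T T H' \<cdot> (\<one> T \<otimes> (\<one> T \<otimes> p)))"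
      by (simp add: exp evp[symmetric] whisker_left assoc_comp)
    also have "\<dots> = (ev' \<cdot> (\<one> T \<otimes> R')) \<cdot> (\<one> T \<otimes> (\<one> T \<otimes> p))"
      by (simp add: evR' assoc_comp)
    also have "\<dots> = ev' \<cdot> (\<one> T \<otimes> (R' \<cdot> (\<one> T \<otimes> p)))"
      by (simp add: whisker_left assoc_comp)
    finally show "eval C T W' \<cdot> (\<one> T \<otimes> (p \<cdot> R)) = eval C T W' \<cdot> (\<one> T \<otimes> (R' \<cdot> (\<one> T \<otimes> p)))"
      by (simp add: ev'_def)
  qed (simp_all add: hom_iff H'_def[symmetric])
  then show ?thesis by (simp add: p_def R_def R'_def)
qed


section \<open>The equalizer of two actions\<close>

text \<open>The universal property of the equalizer of the adjoints of \<open>\<alpha>\<close> and \<open>\<beta>\<close>, stated without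
  adjoints: \<open>q\<close> is universal among the arrows \<open>h\<close> into \<open>X\<close> such that \<open>\<alpha>\<close> and \<open>\<beta>\<close> agree
  on \<open>T \<otimes> h\<close>.\<close>

lemma flat_equalizer:
  assumes X: "X \<in> Ob C" and \<alpha>: "\<alpha> \<in> hom C (T \<odot> X) X" and \<beta>: "\<beta> \<in> hom C (T \<odot> X) X"
    and eq: "is_equalizer C (flat C T X \<alpha>) (flat C T X \<beta>) e q"
  shows "q \<in> hom C e X" "\<alpha> \<cdot> (\<one> T \<otimes> q) = \<beta> \<cdot> (\<one> T \<otimes> q)"
    and "\<And>h x. h \<in> hom C x X \<Longrightarrow> \<alpha> \<cdot> (\<one> T \<otimes> h) = \<beta> \<cdot> (\<one> T \<otimes> h) \<Longrightarrow>
      \<exists>!k. k \<in> hom C x e \<and> q \<cdot> k = h"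
proof -
  have D: "Dom C (flat C T X \<alpha>) = X"
    using adj_eval(1)[OF X T_ob X \<alpha>] by (simp add: hom_iff)
  show q: "q \<in> hom C e X" using eq D by (simp add: is_equalizer_def)
  show "\<alpha> \<cdot> (\<one> T \<otimes> q) = \<beta> \<cdot> (\<one> T \<otimes> q)"
    using eq adj_comp_eq_iff[OF X T_ob X \<alpha> \<beta> q] by (simp add: is_equalizer_def)
  fix h x
  assume h: "h \<in> hom C x X" and a: "\<alpha> \<cdot> (\<one> T \<otimes> h) = \<beta> \<cdot> (\<one> T \<otimes> h)"
  have "flat C T X \<alpha> \<cdot> h = flat C T X \<beta> \<cdot> h"
    using adj_comp_eq_iff[OF X T_ob X \<alpha> \<beta> h] a by simp
  then show "\<exists>!k. k \<in> hom C x e \<and> q \<cdot> k = h"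
    using eq h D by (simp add: is_equalizer_def)
qed

text \<open>If \<open>\<alpha>\<close> and \<open>\<beta>\<close> are multiplicative and agree on \<open>T \<otimes> q\<close>, then they agree on
  \<open>T \<otimes> (\<alpha> \<cdot> (T \<otimes> q))\<close>: either composite is the action of the product of the two
  arguments in \<open>T\<close>.\<close>

lemma multiplicative_agree:
  assumes X: "X \<in> Ob C" and \<alpha>: "multiplicative X \<alpha>" and \<beta>: "multiplicative X \<beta>"
    and q: "q \<in> hom C e X" and eq: "\<alpha> \<cdot> (\<one> T \<otimes> q) = \<beta> \<cdot> (\<one> T \<otimes> q)"
  shows "\<alpha> \<cdot> (\<one> T \<otimes> (\<alpha> \<cdot> (\<one> T \<otimes> q))) = \<beta> \<cdot> (\<one> T \<otimes> (\<alpha> \<cdot> (\<one> T \<otimes> q)))"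
proof -
  have tq [simp]: "q \<in> Arr C" "Dom C q = e" "Cod C q = X"
    using q by (auto simp: hom_iff)
  have [simp]: "e \<in> Ob C" using arr_types(1)[OF tq(1)] by simp
  note [simp] = X
  have act: "(\<gamma> \<cdot> (\<one> T \<otimes> (\<gamma> \<cdot> (\<one> T \<otimes> q)))) \<cdot> assoc C T T e
      = (\<gamma> \<cdot> (\<one> T \<otimes> q)) \<cdot> (\<mu> \<otimes> \<one> e)"
    if "multiplicative X \<gamma>" for \<gamma>
  proof -
    have [simp]: "\<gamma> \<in> Arr C" "Dom C \<gamma> = T \<odot> X" "Cod C \<gamma> = X"
      and g: "\<gamma> \<cdot> (\<one> T \<otimes> \<gamma>) \<cdot> assoc C T T X = \<gamma> \<cdot> (\<mu> \<otimes> \<one> X)"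
      using that by (auto simp: multiplicative_def hom_iff)
    have "(\<gamma> \<cdot> (\<one> T \<otimes> (\<gamma> \<cdot> (\<one> T \<otimes> q)))) \<cdot> assoc C T T e
        = \<gamma> \<cdot> (\<one> T \<otimes> \<gamma>) \<cdot> ((\<one> T \<otimes> (\<one> T \<otimes> q)) \<cdot> assoc C T T e)"
      by (simp add: whisker_left assoc_comp)
    also have "\<dots> = (\<gamma> \<cdot> (\<one> T \<otimes> \<gamma>) \<cdot> assoc C T T X) \<cdot> (\<one> (T \<odot> T) \<otimes> q)"
      by (simp add: assoc_natural_left assoc_comp)
    also have "\<dots> = (\<gamma> \<cdot> (\<one> T \<otimes> q)) \<cdot> (\<mu> \<otimes> \<one> e)"
      unfolding g by (simp add: interchange assoc_comp)
    finally show ?thesis .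
  qed
  have t: "\<alpha> \<in> Arr C" "Dom C \<alpha> = T \<odot> X" "Cod C \<alpha> = X"
      "\<beta> \<in> Arr C" "Dom C \<beta> = T \<odot> X" "Cod C \<beta> = X"
    using \<alpha> \<beta> by (auto simp: multiplicative_def hom_iff)
  show ?thesis
  proof (rule iso_cancel_right)
    show "iso C (assoc C T T e)" by (simp add: assoc_iso)
    show "(\<alpha> \<cdot> (\<one> T \<otimes> (\<alpha> \<cdot> (\<one> T \<otimes> q)))) \<cdot> assoc C T T e
        = (\<beta> \<cdot> (\<one> T \<otimes> (\<alpha> \<cdot> (\<one> T \<otimes> q)))) \<cdot> assoc C T T e"
      using act[OF \<alpha>] act[OF \<beta>] by (simp add: eq)
  qed (use t in simp_all)
qed

lemma left_action_restrict:
  assumes act: "left_action C T \<mu> \<iota> X \<alpha>" and q: "monic C q" "q \<in> hom C e X"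
    and s: "s \<in> hom C (T \<odot> e) e" and qs: "q \<cdot> s = \<alpha> \<cdot> (\<one> T \<otimes> q)"
  shows "left_action C T \<mu> \<iota> e s"
proof -
  have t [simp]: "q \<in> Arr C" "Dom C q = e" "Cod C q = X"
      "s \<in> Arr C" "Dom C s = T \<odot> e" "Cod C s = e"
      "\<alpha> \<in> Arr C" "Dom C \<alpha> = T \<odot> X" "Cod C \<alpha> = X" "X \<in> Ob C"
    using act q s by (auto simp: left_action_def hom_iff)
  have [simp]: "e \<in> Ob C" using arr_types(1)[OF t(1)] by simp
  have unit: "\<alpha> \<cdot> (\<iota> \<otimes> \<one> X) = lunit C X"
    and mult: "\<alpha> \<cdot> (\<one> T \<otimes> \<alpha>) \<cdot> assoc C T T X = \<alpha> \<cdot> (\<mu> \<otimes> \<one> X)"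
    using act by (auto simp: left_action_def)
  have mono: "g = h" if "g \<in> hom C x e" "h \<in> hom C x e" "q \<cdot> g = q \<cdot> h" for g h x
    using q(1) that by (simp add: monic_def)
  have "s \<cdot> (\<iota> \<otimes> \<one> e) = lunit C e"
  proof (rule mono)
    have "q \<cdot> s \<cdot> (\<iota> \<otimes> \<one> e) = \<alpha> \<cdot> ((\<one> T \<otimes> q) \<cdot> (\<iota> \<otimes> \<one> e))"
      by (simp add: comp_eq_extend[OF qs] assoc_comp)
    also have "\<dots> = (\<alpha> \<cdot> (\<iota> \<otimes> \<one> X)) \<cdot> (\<one> (unit_ob C) \<otimes> q)"
      by (simp add: interchange assoc_comp)
    also have "\<dots> = q \<cdot> lunit C e"
      unfolding unit using lunit_natural[OF q(2)] by simp
    finally show "q \<cdot> s \<cdot> (\<iota> \<otimes> \<one> e) = q \<cdot> lunit C e" .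
  qed (simp_all add: hom_iff)
  moreover have "s \<cdot> (\<one> T \<otimes> s) \<cdot> assoc C T T e = s \<cdot> (\<mu> \<otimes> \<one> e)"
  proof (rule mono)
    have "q \<cdot> s \<cdot> (\<one> T \<otimes> s) \<cdot> assoc C T T e
        = \<alpha> \<cdot> (\<one> T \<otimes> (q \<cdot> s)) \<cdot> assoc C T T e"
      by (simp add: comp_eq_extend[OF qs] whisker_left assoc_comp)
    also have "\<dots> = \<alpha> \<cdot> (\<one> T \<otimes> \<alpha>) \<cdot> ((\<one> T \<otimes> (\<one> T \<otimes> q)) \<cdot> assoc C T T e)"
      by (simp add: qs whisker_left assoc_comp)
    also have "\<dots> = (\<alpha> \<cdot> (\<one> T \<otimes> \<alpha>) \<cdot> assoc C T T X) \<cdot> (\<one> (T \<odot> T) \<otimes> q)"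
      by (simp add: assoc_natural_left assoc_comp)
    also have "\<dots> = (\<alpha> \<cdot> (\<one> T \<otimes> q)) \<cdot> (\<mu> \<otimes> \<one> e)"
      unfolding mult by (simp add: interchange assoc_comp)
    also have "\<dots> = q \<cdot> s \<cdot> (\<mu> \<otimes> \<one> e)"
      by (simp add: qs[symmetric] assoc_comp)
    finally show "q \<cdot> s \<cdot> (\<one> T \<otimes> s) \<cdot> assoc C T T e = q \<cdot> s \<cdot> (\<mu> \<otimes> \<one> e)" .
  qed (simp_all add: hom_iff)
  ultimately show ?thesis by (simp add: left_action_def hom_iff)
qed


section \<open>The equalizer of shift and transfer operator\<close>

lemma action_equalizer_exists:
  assumes "has_equalizers C" and act: "left_action C T \<mu> \<iota> W \<Phi>"
  shows "\<exists>e q. action_equalizer C T \<mu> W \<Phi> e q"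
proof -
  have W: "W \<in> Ob C" and \<Phi>: "\<Phi> \<in> hom C (T \<odot> W) W"
    using act by (auto simp: left_action_def)
  let ?H = "ihom C T W"
  have H: "?H \<in> Ob C" using W by simp
  have "flat C T ?H (shift C T \<mu> W) \<in> hom C ?H (ihom C T ?H)"
      "flat C T ?H (transfer C T W \<Phi>) \<in> hom C ?H (ihom C T ?H)"
    using adj_eval(1)[OF H T_ob H] shift_eval(1)[OF W] transfer_eval(1)[OF W \<Phi>] by simp_all
  moreover from this obtain e q where
    "is_equalizer C (flat C T ?H (shift C T \<mu> W)) (flat C T ?H (transfer C T W \<Phi>)) e q"
    using assms(1) by (metis has_equalizers_def)
  ultimately show ?thesis
    by (auto simp: action_equalizer_def is_equalizer_def hom_iff)
qed

lemma action_equalizer_universal: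
  assumes act: "left_action C T \<mu> \<iota> W \<Phi>" and eq: "action_equalizer C T \<mu> W \<Phi> e q"
  shows "q \<in> hom C e (ihom C T W)" "monic C q"
    and "shift C T \<mu> W \<cdot> (\<one> T \<otimes> q) = transfer C T W \<Phi> \<cdot> (\<one> T \<otimes> q)"
    and "\<And>h x. h \<in> hom C x (ihom C T W) \<Longrightarrow>
      shift C T \<mu> W \<cdot> (\<one> T \<otimes> h) = transfer C T W \<Phi> \<cdot> (\<one> T \<otimes> h) \<Longrightarrow>
      \<exists>!k. k \<in> hom C x e \<and> q \<cdot> k = h"
proof -
  have W: "W \<in> Ob C" and \<Phi>: "\<Phi> \<in> hom C (T \<odot> W) W"
    using act by (auto simp: left_action_def)
  have e: "is_equalizer C (flat C T (ihom C T W) (shift C T \<mu> W))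
      (flat C T (ihom C T W) (transfer C T W \<Phi>)) e q"
    using eq by (simp add: action_equalizer_def)
  show "monic C q" using e by (rule is_equalizer_monic)
  note u = flat_equalizer[OF _ shift_eval(1)[OF W] transfer_eval(1)[OF W \<Phi>] e]
  show "q \<in> hom C e (ihom C T W)"
    and "shift C T \<mu> W \<cdot> (\<one> T \<otimes> q) = transfer C T W \<Phi> \<cdot> (\<one> T \<otimes> q)"
    and "\<And>h x. h \<in> hom C x (ihom C T W) \<Longrightarrow>
      shift C T \<mu> W \<cdot> (\<one> T \<otimes> h) = transfer C T W \<Phi> \<cdot> (\<one> T \<otimes> h) \<Longrightarrow>
      \<exists>!k. k \<in> hom C x e \<and> q \<cdot> k = h"
    using u W by simp_all
qed

lemma restricted_shift_unique_exists:
  assumes act: "left_action C T \<mu> \<iota> W \<Phi>" and eq: "action_equalizer C T \<mu> W \<Phi> e q"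
  shows "\<exists>!s. restricted_shift C T \<mu> W \<Phi> e q s"
proof -
  have W: "W \<in> Ob C" and \<Phi>: "multiplicative W \<Phi>"
    using act by (auto simp: left_action_def multiplicative_def)
  note u = action_equalizer_universal[OF act eq]
  have agree: "shift C T \<mu> W \<cdot> (\<one> T \<otimes> (shift C T \<mu> W \<cdot> (\<one> T \<otimes> q)))
      = transfer C T W \<Phi> \<cdot> (\<one> T \<otimes> (shift C T \<mu> W \<cdot> (\<one> T \<otimes> q)))"
    using multiplicative_agree[OF _ shift_multiplicative[OF W]
        transfer_multiplicative[OF W \<Phi>] u(1,3)] W by simp
  have "shift C T \<mu> W \<cdot> (\<one> T \<otimes> q) \<in> hom C (T \<odot> e) (ihom C T W)"
    using u(1) W by (auto simp: hom_iff)
  from u(4)[OF this agree] show ?thesis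
    using u(3) by (simp add: restricted_shift_def)
qed

lemma restricted_shift_left_action:
  assumes act: "left_action C T \<mu> \<iota> W \<Phi>" and eq: "action_equalizer C T \<mu> W \<Phi> e q"
    and s: "restricted_shift C T \<mu> W \<Phi> e q s"
  shows "left_action C T \<mu> \<iota> e s"
proof (rule left_action_restrict)
  show "left_action C T \<mu> \<iota> (ihom C T W) (shift C T \<mu> W)"
    using act by (intro shift_left_action) (simp add: left_action_def)
qed (use action_equalizer_universal[OF act eq] s in \<open>auto simp: restricted_shift_def\<close>)

text \<open>Postcomposition with \<open>f\<close> is a morphism for both actions, hence carries one equalizer
  into the other; it commutes with the restricted shifts because \<open>q'\<close> is monic.\<close>

lemma action_morphism_lift:
  assumes act: "left_action C T \<mu> \<iota> W \<Phi>" and eq: "action_equalizer C T \<mu> W \<Phi> e q"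
    and s: "restricted_shift C T \<mu> W \<Phi> e q s"
    and act': "left_action C T \<mu> \<iota> W' \<Psi>" and eq': "action_equalizer C T \<mu> W' \<Psi> e' q'"
    and s': "restricted_shift C T \<mu> W' \<Psi> e' q' s'"
    and f: "action_morphism C T W \<Phi> W' \<Psi> f"
  shows "\<exists>!k. k \<in> hom C e e' \<and> q' \<cdot> k = ihom_map C T f \<cdot> q \<and> k \<cdot> s = s' \<cdot> (\<one> T \<otimes> k)"
proof -
  have [simp]: "W \<in> Ob C" "W' \<in> Ob C"
    and \<Phi>: "\<Phi> \<in> hom C (T \<odot> W) W" and \<Psi>: "\<Psi> \<in> hom C (T \<odot> W') W'"
    using act act' by (auto simp: left_action_def)
  have fh: "f \<in> hom C W W'" using f by (simp add: action_morphism_def)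
  note u = action_equalizer_universal[OF act eq]
  note u' = action_equalizer_universal[OF act' eq']
  define p where "p = ihom_map C T f"
  define S where "S = shift C T \<mu> W"
  define S' where "S' = shift C T \<mu> W'"
  define R where "R = transfer C T W \<Phi>"
  define R' where "R' = transfer C T W' \<Psi>"
  have t [simp]:
      "q \<in> Arr C" "Dom C q = e" "Cod C q = ihom C T W"
      "q' \<in> Arr C" "Dom C q' = e'" "Cod C q' = ihom C T W'"
      "p \<in> Arr C" "Dom C p = ihom C T W" "Cod C p = ihom C T W'"
      "S \<in> Arr C" "Dom C S = T \<odot> ihom C T W" "Cod C S = ihom C T W"
      "S' \<in> Arr C" "Dom C S' = T \<odot> ihom C T W'" "Cod C S' = ihom C T W'"
      "R \<in> Arr C" "Dom C R = T \<odot> ihom C T W" "Cod C R = ihom C T W"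
      "R' \<in> Arr C" "Dom C R' = T \<odot> ihom C T W'" "Cod C R' = ihom C T W'"
      "s \<in> Arr C" "Dom C s = T \<odot> e" "Cod C s = e"
      "s' \<in> Arr C" "Dom C s' = T \<odot> e'" "Cod C s' = e'"
    using u(1) u'(1) s s' ihom_map_eval(1)[OF T_ob fh] transfer_eval(1)[OF _ \<Phi>]
      transfer_eval(1)[OF _ \<Psi>]
    by (auto simp: restricted_shift_def hom_iff p_def S_def S'_def R_def R'_def)
  have [simp]: "e \<in> Ob C" "e' \<in> Ob C"
    using arr_types(1)[OF t(1)] arr_types(1)[OF t(4)] by simp_all
  have qs: "q \<cdot> s = S \<cdot> (\<one> T \<otimes> q)" and qs': "q' \<cdot> s' = S' \<cdot> (\<one> T \<otimes> q')"
    using s s' by (simp_all add: restricted_shift_def S_def S'_def)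
  have pS: "p \<cdot> S = S' \<cdot> (\<one> T \<otimes> p)" and pR: "p \<cdot> R = R' \<cdot> (\<one> T \<otimes> p)"
    using ihom_map_shift[OF fh] ihom_map_transfer[OF \<Phi> \<Psi> f]
    by (simp_all add: p_def S_def S'_def R_def R'_def)
  have "S' \<cdot> (\<one> T \<otimes> (p \<cdot> q)) = p \<cdot> (S \<cdot> (\<one> T \<otimes> q))"
    by (simp add: whisker_left comp_eq_extend[OF pS] assoc_comp)
  also have "\<dots> = p \<cdot> (R \<cdot> (\<one> T \<otimes> q))"
    using u(3) by (simp add: S_def R_def)
  also have "\<dots> = R' \<cdot> (\<one> T \<otimes> (p \<cdot> q))"
    by (simp add: whisker_left comp_eq_extend[OF pR] assoc_comp)
  finally have "\<exists>!k. k \<in> hom C e e' \<and> q' \<cdot> k = p \<cdot> q"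
    unfolding S'_def R'_def by (intro u'(4)) (simp_all add: hom_iff)
  moreover have "k \<cdot> s = s' \<cdot> (\<one> T \<otimes> k)" if k: "k \<in> hom C e e'" "q' \<cdot> k = p \<cdot> q" for k
  proof -
    have [simp]: "k \<in> Arr C" "Dom C k = e" "Cod C k = e'" using k(1) by (auto simp: hom_iff)
    have "q' \<cdot> (k \<cdot> s) = p \<cdot> (q \<cdot> s)"
      by (simp add: comp_eq_extend[OF k(2)] assoc_comp)
    also have "\<dots> = S' \<cdot> (\<one> T \<otimes> (p \<cdot> q))"
      by (simp add: qs comp_eq_extend[OF pS] whisker_left assoc_comp)
    also have "\<dots> = q' \<cdot> (s' \<cdot> (\<one> T \<otimes> k))"
      by (simp add: k(2)[symmetric] comp_eq_extend[OF qs'] whisker_left assoc_comp)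
    finally have "q' \<cdot> (k \<cdot> s) = q' \<cdot> (s' \<cdot> (\<one> T \<otimes> k))" .
    moreover have "k \<cdot> s \<in> hom C (T \<odot> e) (Dom C q')"
        "s' \<cdot> (\<one> T \<otimes> k) \<in> hom C (T \<odot> e) (Dom C q')"
      by (simp_all add: hom_iff)
    ultimately show ?thesis using u'(2) unfolding monic_def by blast
  qed
  ultimately show ?thesis unfolding p_def by blast
qed

end


section \<open>Restriction to the equalizer and functoriality\<close>

theorem theorem6:
  fixes C :: "('o, 'm, 'x) closed_symmetric_monoidal_category_scheme" (structure)
    and \<T> :: "('a, 'o, 'm, 'y) enriched_category_scheme"
    and pt :: 'a and T \<Omega> :: 'o and \<mu> \<iota> \<Phi> :: 'm
  assumes "closed_symmetric_monoidal_category C"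
    and "has_equalizers C"
    and "enriched_category C \<T>"
    and "eob \<T> = {pt}"
    and "T = ehom \<T> pt pt"
    and "\<mu> = ecomp \<T> pt pt pt"
    and "\<iota> = eunit \<T> pt"
    and "left_action C T \<mu> \<iota> \<Omega> \<Phi>"
  shows "(\<exists>E q. action_equalizer C T \<mu> \<Omega> \<Phi> E q) \<and>
    (\<forall>E q. action_equalizer C T \<mu> \<Omega> \<Phi> E q \<longrightarrow>
      monic C q \<and>
      (\<exists>!s. restricted_shift C T \<mu> \<Omega> \<Phi> E q s) \<and>
      (\<forall>s. restricted_shift C T \<mu> \<Omega> \<Phi> E q s \<longrightarrow>
        left_action C T \<mu> \<iota> E s \<and>
        (\<forall>\<Omega>' \<Psi> f E' q' s'.
          left_action C T \<mu> \<iota> \<Omega>' \<Psi> \<and>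
          action_morphism C T \<Omega> \<Phi> \<Omega>' \<Psi> f \<and>
          action_equalizer C T \<mu> \<Omega>' \<Psi> E' q' \<and>
          restricted_shift C T \<mu> \<Omega>' \<Psi> E' q' s' \<longrightarrow>
          (\<exists>!Ef. Ef \<in> hom C E E' \<and>
            q' \<cdot> Ef = ihom_map C T f \<cdot> q \<and>
            Ef \<cdot> s = s' \<cdot> (\<one> T \<otimes> Ef)))))"
proof -
  interpret closed_symmetric_monoidal_category C by fact
  have pt: "pt \<in> eob \<T>" using assms by simp
  interpret internal_monoid C T \<mu> \<iota>
    using enriched_category.ehom_closed[OF assms(3) pt pt]
      enriched_category.ecomp_closed[OF assms(3) pt pt pt]
      enriched_category.eunit_closed[OF assms(3) pt]
      enriched_category.ecomp_assoc[OF assms(3) pt pt pt pt]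
      enriched_category.eunit_right[OF assms(3) pt pt]
    by unfold_locales (simp_all add: assms(5-7))
  note act = assms(8)
  show ?thesis
    by (intro conjI allI impI; (elim conjE)?)
      (rule action_equalizer_exists[OF assms(2) act] action_equalizer_universal(2)[OF act]
        restricted_shift_unique_exists[OF act] restricted_shift_left_action[OF act]
        action_morphism_lift[OF act]; assumption)+
qed

end
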